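(* Let $G$ be a locally compact group, let $\rho$ be a unitary representation of $G$ having a separating set $\mathcal{P}$ of norm one $G$-positive vectors, and let $\pi$ be any unitary representation of $G$. Then for every probability measure $\mu$ on $G$ we have $$\|(\rho\otimes\pi)(\mu)\| \leq \|\rho(\mu)\|.$$
   Context: Standing assumption: locally compact groups are second countable. For a (strongly continuous) unitary representation $\pi$ of $G$ on a Hilbert space and a bounded measure $\mu$ on $G$, $\pi(\mu)=\int_G\pi(s)\,d\mu(s)$. A vector $\xi$ in the Hilbert space $\mathcal{H}(\rho)$ of $\rho$ is $G$-positive if $\langle\xi,\rho(s)\xi\rangle\ge 0$ for all $s\in G$. A set $\mathcal{P}$ of vectors of a Hilbert space $\mathcal{H}$ is separating if, for a bounded operator $S$ on $\mathcal{H}$, $S\xi=0$ for all $\xi\in\mathcal{P}$ implies $S=0$. *)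

theory Defs
  imports "HOL-Probability.Probability_Measure"
begin

section \<open>Complex Hilbert spaces\<close>

text \<open>The scalar product is antilinear in the first and linear in the second argument.\<close>

class chilbert_space = banach +
  fixes scaleC :: "complex \<Rightarrow> 'a \<Rightarrow> 'a"  (infixr \<open>*\<^sub>C\<close> 75)
    and cinner :: "'a \<Rightarrow> 'a \<Rightarrow> complex"
  assumes scaleC_add_right: "a *\<^sub>C (x + y) = a *\<^sub>C x + a *\<^sub>C y"
    and scaleC_add_left: "(a + b) *\<^sub>C x = a *\<^sub>C x + b *\<^sub>C x"
    and scaleC_scaleC: "a *\<^sub>C b *\<^sub>C x = (a * b) *\<^sub>C x"
    and scaleR_scaleC: "r *\<^sub>R x = complex_of_real r *\<^sub>C x"
    and cinner_commute: "cinner x y = cnj (cinner y x)"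
    and cinner_add_right: "cinner x (y + z) = cinner x y + cinner x z"
    and cinner_scaleC_right: "cinner x (a *\<^sub>C y) = a * cinner x y"
    and cinner_eq_norm: "cinner x x = complex_of_real ((norm x)\<^sup>2)"

instantiation complex :: chilbert_space
begin
definition "scaleC_complex = (\<lambda>a x :: complex. a * x)"
definition "cinner_complex = (\<lambda>x y :: complex. cnj x * y)"
instance
proof
  fix a b x y z :: complex and r :: real
  show "a *\<^sub>C (x + y) = a *\<^sub>C x + a *\<^sub>C y" "(a + b) *\<^sub>C x = a *\<^sub>C x + b *\<^sub>C x"
    "a *\<^sub>C b *\<^sub>C x = (a * b) *\<^sub>C x" "r *\<^sub>R x = complex_of_real r *\<^sub>C x"
    by (simp_all add: scaleC_complex_def algebra_simps scaleR_conv_of_real)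
  show "cinner x y = cnj (cinner y x)" "cinner x (y + z) = cinner x y + cinner x z"
    "cinner x (a *\<^sub>C y) = a * cinner x y"
    by (simp_all add: cinner_complex_def scaleC_complex_def algebra_simps)
  show "cinner x x = complex_of_real ((norm x)\<^sup>2)"
    unfolding cinner_complex_def complex_norm_square by (rule mult.commute)
qed
end

lemma cinner_add_left: "cinner (x + y) z = cinner x z + cinner y z"
  for x y z :: "'a::chilbert_space"
  using cinner_add_right[of z x y] cinner_commute by (metis complex_cnj_add)

lemma cinner_scaleC_left: "cinner (a *\<^sub>C x) y = cnj a * cinner x y"
  for x y :: "'a::chilbert_space"
  using cinner_scaleC_right[of y a x] cinner_commute by (metis complex_cnj_mult)

lemma cinner_zero_right [simp]: "cinner x 0 = 0" for x :: "'a::chilbert_space"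
  using cinner_add_right[of x 0 0] by simp

lemma cinner_zero_left [simp]: "cinner 0 x = 0" for x :: "'a::chilbert_space"
  using cinner_add_left[of 0 0 x] by simp

lemma cinner_minus_right: "cinner x (- y) = - cinner x y" for x :: "'a::chilbert_space"
  using cinner_add_right[of x y "- y"] by (simp add: add_eq_0_iff)

lemma cinner_minus_left: "cinner (- x) y = - cinner x y" for x :: "'a::chilbert_space"
  using cinner_add_left[of x "- x" y] by (simp add: add_eq_0_iff)

lemma cinner_diff_right: "cinner x (y - z) = cinner x y - cinner x z"
  for x :: "'a::chilbert_space"
  using cinner_add_right[of x y "- z"] by (simp add: cinner_minus_right)

lemma cinner_diff_left: "cinner (x - y) z = cinner x z - cinner y z"
  for x :: "'a::chilbert_space"
  using cinner_add_left[of x "- y" z] by (simp add: cinner_minus_left)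

lemma cinner_sum_right: "cinner x (sum f F) = (\<Sum>i\<in>F. cinner x (f i))"
  for x :: "'a::chilbert_space"
  by (induction F rule: infinite_finite_induct) (auto simp: cinner_add_right)

lemma cinner_sum_left: "cinner (sum f F) x = (\<Sum>i\<in>F. cinner (f i) x)"
  for x :: "'a::chilbert_space"
  by (induction F rule: infinite_finite_induct) (auto simp: cinner_add_left)

lemma scaleC_zero_right [simp]: "a *\<^sub>C (0::'a::chilbert_space) = 0"
  using scaleC_add_right[of a "0::'a" 0] by simp

lemma scaleC_zero_left [simp]: "0 *\<^sub>C (x::'a::chilbert_space) = 0"
  using scaleC_add_left[of 0 0 x] by simp

lemma scaleC_one [simp]: "1 *\<^sub>C (x::'a::chilbert_space) = x"
  using scaleR_scaleC[of 1 x] by simp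

lemma scaleC_minus_left: "(- a) *\<^sub>C x = - (a *\<^sub>C (x::'a::chilbert_space))"
  using scaleC_add_left[of a "-a" x] by (simp add: add_eq_0_iff)

lemma scaleC_minus_right: "a *\<^sub>C (- x) = - (a *\<^sub>C (x::'a::chilbert_space))"
  using scaleC_add_right[of a x "-x"] by (simp add: add_eq_0_iff)

lemma scaleC_diff_right: "a *\<^sub>C (x - y) = a *\<^sub>C x - a *\<^sub>C (y::'a::chilbert_space)"
  using scaleC_add_right[of a x "- y"] by (simp add: scaleC_minus_right)

lemma scaleC_diff_left: "(a - b) *\<^sub>C x = a *\<^sub>C x - b *\<^sub>C (x::'a::chilbert_space)"
  using scaleC_add_left[of a "- b" x] by (simp add: scaleC_minus_left)

lemma scaleC_sum_right: "a *\<^sub>C sum f F = (\<Sum>i\<in>F. a *\<^sub>C (f i :: 'a::chilbert_space))"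
  by (induction F rule: infinite_finite_induct) (auto simp: scaleC_add_right)

lemma norm_eq_sqrt_cinner: "norm x = sqrt (Re (cinner x x))" for x :: "'a::chilbert_space"
  by (simp add: cinner_eq_norm)

lemma norm_sq_cinner: "(norm x)\<^sup>2 = Re (cinner x x)" for x :: "'a::chilbert_space"
  by (simp add: cinner_eq_norm)

lemma cinner_self_eq_0 [simp]: "cinner x x = 0 \<longleftrightarrow> x = 0" for x :: "'a::chilbert_space"
  by (simp add: cinner_eq_norm)

lemma norm_scaleC [simp]: "norm (a *\<^sub>C x) = cmod a * norm (x :: 'a::chilbert_space)"
proof -
  have "cinner (a *\<^sub>C x) (a *\<^sub>C x) = (a * cnj a) * cinner x x"
    by (simp add: cinner_scaleC_left cinner_scaleC_right)
  also have "\<dots> = of_real ((cmod a)\<^sup>2) * of_real ((norm x)\<^sup>2)"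
    by (simp only: complex_norm_square cinner_eq_norm)
  also have "\<dots> = of_real ((cmod a * norm x)\<^sup>2)"
    by (simp add: power_mult_distrib)
  finally show ?thesis by (simp add: norm_eq_sqrt_cinner[of "a *\<^sub>C x"])
qed

lemma cinner_ext: "(\<And>z. cinner z x = cinner z y) \<Longrightarrow> x = y" for x y :: "'a::chilbert_space"
  by (metis cinner_diff_right cinner_self_eq_0 right_minus_eq)

lemma norm_cinner_le: "cmod (cinner x y) \<le> norm x * norm y" for x y :: "'a::chilbert_space"
proof (cases "x = 0")
  case False
  define c where "c = cinner x y / of_real ((norm x)\<^sup>2)"
  have n: "complex_of_real ((norm x)\<^sup>2) \<noteq> 0" using False by simp
  have orth: "cinner x (y - c *\<^sub>C x) = 0"
    using n unfolding c_def by (simp add: cinner_diff_right cinner_scaleC_right cinner_eq_norm)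
  have "cinner (y - c *\<^sub>C x) (y - c *\<^sub>C x) = cinner y (y - c *\<^sub>C x)"
    using orth by (simp add: cinner_diff_left cinner_scaleC_left)
  also have "\<dots> = cinner y y - c * cinner y x"
    by (simp add: cinner_diff_right cinner_scaleC_right)
  also have "c * cinner y x = of_real ((cmod (cinner x y))\<^sup>2 / (norm x)\<^sup>2)"
    unfolding c_def by (subst cinner_commute[of y x])
      (simp only: of_real_divide complex_norm_square times_divide_eq_left)
  finally have "of_real ((norm (y - c *\<^sub>C x))\<^sup>2)
      = complex_of_real ((norm y)\<^sup>2 - (cmod (cinner x y))\<^sup>2 / (norm x)\<^sup>2)"
    by (simp add: cinner_eq_norm)
  then have "(norm (y - c *\<^sub>C x))\<^sup>2 = (norm y)\<^sup>2 - (cmod (cinner x y))\<^sup>2 / (norm x)\<^sup>2"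
    by (simp only: of_real_eq_iff)
  then have "(cmod (cinner x y))\<^sup>2 / (norm x)\<^sup>2 \<le> (norm y)\<^sup>2"
    by (smt (verit) zero_le_power2)
  then have "(cmod (cinner x y))\<^sup>2 \<le> (norm x * norm y)\<^sup>2"
    using False by (simp add: pos_divide_le_eq power_mult_distrib mult.commute)
  then show ?thesis by (rule power2_le_imp_le) simp
qed simp

lemma bounded_bilinear_cinner: "bounded_bilinear (cinner :: 'a::chilbert_space \<Rightarrow> 'a \<Rightarrow> complex)"
proof
  fix x y z :: 'a and r :: real
  show "cinner (x + y) z = cinner x z + cinner y z" by (rule cinner_add_left)
  show "cinner x (y + z) = cinner x y + cinner x z" by (rule cinner_add_right)
  show "cinner (r *\<^sub>R x) y = r *\<^sub>R cinner x y"
    by (simp add: scaleR_scaleC[of r x] cinner_scaleC_left scaleR_conv_of_real)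
  show "cinner x (r *\<^sub>R y) = r *\<^sub>R cinner x y"
    by (simp add: scaleR_scaleC[of r y] cinner_scaleC_right scaleR_conv_of_real)
  show "\<exists>K. \<forall>x y :: 'a. norm (cinner x y) \<le> norm x * norm y * K"
    by (rule exI[of _ 1]) (simp add: norm_cinner_le)
qed

lemma bounded_bilinear_scaleC:
  "bounded_bilinear (scaleC :: complex \<Rightarrow> 'a::chilbert_space \<Rightarrow> 'a)"
proof
  fix a b :: complex and x y :: 'a and r :: real
  show "(a + b) *\<^sub>C x = a *\<^sub>C x + b *\<^sub>C x" by (rule scaleC_add_left)
  show "a *\<^sub>C (x + y) = a *\<^sub>C x + a *\<^sub>C y" by (rule scaleC_add_right)
  show "(r *\<^sub>R a) *\<^sub>C x = r *\<^sub>R a *\<^sub>C x"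
    by (simp only: scaleR_scaleC[of r "a *\<^sub>C x"] scaleC_scaleC scaleR_conv_of_real)
  show "a *\<^sub>C r *\<^sub>R x = r *\<^sub>R a *\<^sub>C x"
    by (simp only: scaleR_scaleC[of r "a *\<^sub>C x"] scaleR_scaleC[of r x] scaleC_scaleC mult.commute)
  show "\<exists>K. \<forall>(a :: complex) (x :: 'a). norm (a *\<^sub>C x) \<le> norm a * norm x * K"
    by (rule exI[of _ 1]) simp
qed

lemmas bounded_linear_cinner_right = bounded_bilinear.bounded_linear_right[OF bounded_bilinear_cinner]
lemmas bounded_linear_scaleC_right = bounded_bilinear.bounded_linear_right[OF bounded_bilinear_scaleC]
lemmas bounded_linear_scaleC_left = bounded_bilinear.bounded_linear_left[OF bounded_bilinear_scaleC]
lemmas tendsto_cinner [tendsto_intros] = bounded_bilinear.tendsto[OF bounded_bilinear_cinner]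
lemmas tendsto_scaleC [tendsto_intros] = bounded_bilinear.tendsto[OF bounded_bilinear_scaleC]

definition bounded_clinear :: "('a::chilbert_space \<Rightarrow> 'b::chilbert_space) \<Rightarrow> bool" where
  "bounded_clinear S \<longleftrightarrow> bounded_linear S \<and> (\<forall>c x. S (c *\<^sub>C x) = c *\<^sub>C S x)"

definition bounded_antilinear :: "('a::chilbert_space \<Rightarrow> 'b::chilbert_space) \<Rightarrow> bool" where
  "bounded_antilinear S \<longleftrightarrow> bounded_linear S \<and> (\<forall>c x. S (c *\<^sub>C x) = cnj c *\<^sub>C S x)"


section \<open>Orthonormal bases\<close>

definition orthonormal :: "'a::chilbert_space set \<Rightarrow> bool" where
  "orthonormal B \<longleftrightarrow> (\<forall>u\<in>B. norm u = 1) \<and> (\<forall>u\<in>B. \<forall>v\<in>B. u \<noteq> v \<longrightarrow> cinner u v = 0)"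

definition orthonormal_basis :: "'a::chilbert_space set \<Rightarrow> bool" where
  "orthonormal_basis B \<longleftrightarrow> orthonormal B \<and> (\<forall>x. (\<forall>u\<in>B. cinner u x = 0) \<longrightarrow> x = 0)"

lemma orthonormal_cinner:
  "orthonormal B \<Longrightarrow> u \<in> B \<Longrightarrow> v \<in> B \<Longrightarrow> cinner u v = (if u = v then 1 else 0)"
  unfolding orthonormal_def by (auto simp: cinner_eq_norm)

lemma orthonormal_extend:
  assumes "orthonormal (S :: 'a::chilbert_space set)"
  obtains B where "orthonormal_basis B" "S \<subseteq> B"
proof -
  define \<A> where "\<A> = {B. orthonormal B \<and> S \<subseteq> B}"
  have "\<exists>M\<in>\<A>. \<forall>X\<in>\<A>. M \<subseteq> X \<longrightarrow> X = M"
  proof (rule subset_Zorn_nonempty)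
    show "\<A> \<noteq> {}" using assms by (auto simp: \<A>_def)
  next
    fix C assume C: "C \<noteq> {}" "subset.chain \<A> C"
    have "orthonormal (\<Union>C)"
      unfolding orthonormal_def
    proof (intro conjI ballI impI)
      fix u assume "u \<in> \<Union>C"
      then show "norm u = 1" using C by (auto simp: subset_chain_def \<A>_def orthonormal_def)
    next
      fix u v assume "u \<in> \<Union>C" "v \<in> \<Union>C" "u \<noteq> v"
      then obtain X Y where XY: "X \<in> C" "Y \<in> C" "u \<in> X" "v \<in> Y" by auto
      with C have "X \<subseteq> Y \<or> Y \<subseteq> X" by (auto simp: subset_chain_def)
      with XY obtain Z where "Z \<in> C" "u \<in> Z" "v \<in> Z" by blast
      with C \<open>u \<noteq> v\<close> show "cinner u v = 0"
        by (auto simp: subset_chain_def \<A>_def orthonormal_def subset_iff)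
    qed
    moreover obtain X where "X \<in> C" using C by auto
    moreover from this have "S \<subseteq> X" using C by (auto simp: subset_chain_def \<A>_def)
    ultimately show "\<Union>C \<in> \<A>" by (auto simp: \<A>_def)
  qed
  then obtain M where M: "M \<in> \<A>" and max: "\<And>X. X \<in> \<A> \<Longrightarrow> M \<subseteq> X \<Longrightarrow> X = M" by blast
  have "orthonormal_basis M"
    unfolding orthonormal_basis_def
  proof (intro conjI allI impI)
    show "orthonormal M" using M by (simp add: \<A>_def)
    fix x assume x: "\<forall>u\<in>M. cinner u x = 0"
    show "x = 0"
    proof (rule ccontr)
      assume "x \<noteq> 0"
      define e where "e = (1 / norm x) *\<^sub>R x"
      have e: "norm e = 1" using \<open>x \<noteq> 0\<close> by (simp add: e_def)
      have eM: "cinner u e = 0" "cinner e u = 0" if "u \<in> M" for u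
        using x that cinner_commute[of e u]
        by (auto simp: e_def scaleR_scaleC cinner_scaleC_right)
      have "orthonormal (insert e M)"
        using \<open>orthonormal M\<close> e eM by (auto simp: orthonormal_def)
      then have "insert e M = M" using max[of "insert e M"] M by (auto simp: \<A>_def)
      then have "cinner e e = 0" using eM(1)[of e] by blast
      then show False using e by simp
    qed
  qed
  then show ?thesis using that M by (auto simp: \<A>_def)
qed

lemma ex_orthonormal_basis: "\<exists>B :: 'a::chilbert_space set. orthonormal_basis B"
  using orthonormal_extend[of "{}"] by (auto simp: orthonormal_def)

lemma norm_sum_orthonormal:
  assumes "orthonormal B" "finite F" "F \<subseteq> B"
  shows "(norm (\<Sum>u\<in>F. c u *\<^sub>C u))\<^sup>2 = (\<Sum>u\<in>F. (cmod (c u))\<^sup>2)"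
proof -
  have "cinner (\<Sum>u\<in>F. c u *\<^sub>C u) (\<Sum>u\<in>F. c u *\<^sub>C u)
      = (\<Sum>u\<in>F. \<Sum>v\<in>F. cnj (c u) * (c v * cinner u v))"
    by (simp add: cinner_sum_left cinner_scaleC_left)
       (simp add: cinner_sum_right cinner_scaleC_right sum_distrib_left)
  also have "\<dots> = (\<Sum>u\<in>F. \<Sum>v\<in>F. if u = v then cnj (c u) * c u else 0)"
    using assms by (intro sum.cong refl) (auto simp: orthonormal_cinner subset_iff)
  also have "\<dots> = of_real (\<Sum>u\<in>F. (cmod (c u))\<^sup>2)"
    using assms(2) by (simp add: complex_norm_square mult.commute del: of_real_power)
  finally show ?thesis by (simp add: norm_sq_cinner)
qed

lemma bessel:
  assumes "orthonormal B" "finite F" "F \<subseteq> B"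
  shows "(\<Sum>u\<in>F. (cmod (cinner u x))\<^sup>2) \<le> (norm x)\<^sup>2"
proof -
  define p where "p = (\<Sum>u\<in>F. cinner u x *\<^sub>C u)"
  have "cinner u p = cinner u x" if "u \<in> F" for u
  proof -
    have "cinner u p = (\<Sum>v\<in>F. cinner v x * cinner u v)"
      unfolding p_def by (simp add: cinner_sum_right cinner_scaleC_right)
    also have "\<dots> = (\<Sum>v\<in>F. if u = v then cinner v x else 0)"
      using assms that by (intro sum.cong refl) (auto simp: orthonormal_cinner subset_iff)
    finally show ?thesis using assms(2) that by simp
  qed
  then have "cinner p (x - p) = 0"
    by (subst p_def) (simp add: cinner_sum_left cinner_scaleC_left cinner_diff_right)
  then have "cinner (x - p) p = 0" "cinner p (x - p) = 0"
    using cinner_commute[of "x - p" p] by auto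
  then have "cinner (p + (x - p)) (p + (x - p)) = cinner p p + cinner (x - p) (x - p)"
    by (simp only: cinner_add_left cinner_add_right) simp
  then have "(norm x)\<^sup>2 = (norm p)\<^sup>2 + (norm (x - p))\<^sup>2"
    by (simp add: norm_sq_cinner)
  then have "(norm p)\<^sup>2 \<le> (norm x)\<^sup>2" by simp
  then show ?thesis unfolding p_def by (simp add: norm_sum_orthonormal[OF assms])
qed

lemma summable_on_orthonormal:
  assumes B: "orthonormal B" and s: "(\<lambda>u. (cmod (c u))\<^sup>2) summable_on B"
  shows "(\<lambda>u. c u *\<^sub>C u) summable_on B"
proof -
  let ?g = "\<lambda>u. (cmod (c u))\<^sup>2" and ?f = "\<lambda>u. c u *\<^sub>C u"
  let ?FB = "finite_subsets_at_top B"
  obtain S where "(sum ?g \<longlongrightarrow> S) ?FB" using s by (auto simp: summable_on_def has_sum_def)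
  have "\<exists>P. eventually P ?FB \<and> (\<forall>F1 F2. P F1 \<and> P F2 \<longrightarrow> dist (sum ?f F1) (sum ?f F2) < e)"
    if "e > 0" for e
  proof -
    define d where "d = (e/2)\<^sup>2"
    have "d > 0" using that by (simp add: d_def)
    then have "\<forall>\<^sub>F F in ?FB. dist (sum ?g F) S < d / 2"
      using tendstoD[OF \<open>(sum ?g \<longlongrightarrow> S) ?FB\<close>, of "d / 2"] by simp
    then obtain F0 where F0: "finite F0" "F0 \<subseteq> B"
      and F0d: "\<And>F. finite F \<Longrightarrow> F0 \<subseteq> F \<Longrightarrow> F \<subseteq> B \<Longrightarrow> dist (sum ?g F) S < d / 2"
      unfolding eventually_finite_subsets_at_top by metis
    define P where "P F \<longleftrightarrow> finite F \<and> F0 \<subseteq> F \<and> F \<subseteq> B" for F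
    have near: "dist (sum ?f F) (sum ?f F0) < e / 2" if "P F" for F
    proof -
      have F: "finite F" "F0 \<subseteq> F" "F \<subseteq> B" using that by (auto simp: P_def)
      have "(dist (sum ?f F) (sum ?f F0))\<^sup>2 = (norm (sum ?f (F - F0)))\<^sup>2"
        using F by (simp add: dist_norm sum_diff)
      also have "\<dots> = sum ?g (F - F0)" using B F by (subst norm_sum_orthonormal) auto
      also have "\<dots> = sum ?g F - sum ?g F0" using F by (simp add: sum_diff)
      also have "\<dots> < d"
        using F0d[of F] F0d[of F0] F F0 by (auto simp: dist_real_def abs_if split: if_splits)
      finally show ?thesis unfolding d_def
        by (rule power_less_imp_less_base) (use \<open>e > 0\<close> in simp)
    qed
    have "eventually P ?FB"
      unfolding eventually_finite_subsets_at_top using F0 by (auto simp: P_def)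
    moreover have "dist (sum ?f F1) (sum ?f F2) < e" if "P F1 \<and> P F2" for F1 F2
      using near[of F1] near[of F2] that dist_triangle2[of "sum ?f F1" "sum ?f F2" "sum ?f F0"]
      by linarith
    ultimately show ?thesis by blast
  qed
  then have "cauchy_filter (filtermap (sum ?f) ?FB)"
    by (simp add: cauchy_filter_metric_filtermap)
  moreover have "complete (UNIV :: 'a set)"
    by (meson Cauchy_convergent UNIV_I complete_def convergent_def)
  ultimately obtain L where "(sum ?f \<longlongrightarrow> L) ?FB"
    using complete_uniform[where S=UNIV] by (force simp add: filterlim_def)
  then show ?thesis using summable_on_def has_sum_def by blast
qed

lemma bessel_summable:
  assumes "orthonormal B"
  shows "(\<lambda>u. (cmod (cinner u x))\<^sup>2) summable_on B"
proof (rule nonneg_bounded_partial_sums_imp_summable_on)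
  show "\<forall>\<^sub>F F in finite_subsets_at_top B. (\<Sum>u\<in>F. (cmod (cinner u x))\<^sup>2) \<le> (norm x)\<^sup>2"
    by (rule eventually_finite_subsets_at_top_weakI) (rule bessel[OF assms])
qed simp

lemma has_sum_basis_expansion:
  assumes "orthonormal_basis B"
  shows "((\<lambda>u. cinner u x *\<^sub>C u) has_sum x) B"
proof -
  have B: "orthonormal B" using assms by (simp add: orthonormal_basis_def)
  obtain y where y: "((\<lambda>u. cinner u x *\<^sub>C u) has_sum y) B"
    using summable_on_orthonormal[OF B bessel_summable[OF B]] by (auto simp: summable_on_def)
  have "cinner v (x - y) = 0" if "v \<in> B" for v
  proof -
    have "((\<lambda>u. cinner v (cinner u x *\<^sub>C u)) has_sum cinner v y) B"
      by (rule has_sum_bounded_linear[OF bounded_linear_cinner_right y])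
    moreover have "((\<lambda>u. cinner v (cinner u x *\<^sub>C u)) has_sum cinner v x) B"
    proof -
      have "((\<lambda>u. cinner v (cinner u x *\<^sub>C u)) has_sum (\<Sum>u\<in>{v}. cinner u x)) B
          \<longleftrightarrow> ((\<lambda>u. cinner u x) has_sum (\<Sum>u\<in>{v}. cinner u x)) {v}"
        by (rule has_sum_cong_neutral)
           (use that B in \<open>auto simp: cinner_scaleC_right orthonormal_cinner\<close>)
      also have "\<dots>" by (rule has_sum_finite) simp
      finally show ?thesis by simp
    qed
    ultimately show ?thesis using has_sum_unique by (fastforce simp: cinner_diff_right)
  qed
  then have "x - y = 0" using assms unfolding orthonormal_basis_def by blast
  then show ?thesis using y by simp
qed

lemma parseval:
  assumes "orthonormal_basis B"
  shows "((\<lambda>u. cinner x u * cinner u y) has_sum cinner x y) B"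
  using has_sum_bounded_linear[OF bounded_linear_cinner_right has_sum_basis_expansion[OF assms],
    of x y] by (simp add: cinner_scaleC_right mult.commute)

lemma parseval_norm:
  assumes "orthonormal_basis B"
  shows "((\<lambda>u. (cmod (cinner u x))\<^sup>2) has_sum (norm x)\<^sup>2) B"
proof -
  have "((\<lambda>u. Re (cinner x u * cinner u x)) has_sum Re (cinner x x)) B"
    by (rule has_sum_Re[OF parseval[OF assms]])
  moreover have "Re (cinner x u * cinner u x) = (cmod (cinner u x))\<^sup>2" for u
    by (subst cinner_commute[of x u]) (simp add: cmod_power2, simp add: power2_eq_square)
  ultimately show ?thesis by (simp add: norm_sq_cinner)
qed

lemma riesz:
  fixes f :: "'a::chilbert_space \<Rightarrow> complex"
  assumes f: "bounded_clinear f"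
  obtains z where "\<And>x. f x = cinner z x"
proof -
  obtain B :: "'a set" where B: "orthonormal_basis B" using ex_orthonormal_basis by blast
  then have oB: "orthonormal B" by (simp add: orthonormal_basis_def)
  have lin: "bounded_linear f" "f (c *\<^sub>C x) = c * f x" for c x
    using f by (auto simp: bounded_clinear_def scaleC_complex_def)
  then obtain K where K: "\<And>x. cmod (f x) \<le> norm x * K" using bounded_linear.bounded by blast
  have "(\<lambda>u. (cmod (cnj (f u)))\<^sup>2) summable_on B"
  proof (rule nonneg_bounded_partial_sums_imp_summable_on)
    have "(\<Sum>u\<in>F. (cmod (cnj (f u)))\<^sup>2) \<le> K\<^sup>2" if F: "finite F" "F \<subseteq> B" for F
    proof -
      define w where "w = (\<Sum>u\<in>F. cnj (f u) *\<^sub>C u)"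
      define s where "s = (\<Sum>u\<in>F. (cmod (f u))\<^sup>2)"
      have s0: "0 \<le> s" unfolding s_def by (simp add: sum_nonneg)
      have "f w = (\<Sum>u\<in>F. cnj (f u) * f u)" unfolding w_def
        by (simp add: linear_sum[OF bounded_linear.linear[OF lin(1)]] lin(2))
      also have "\<dots> = of_real s" unfolding s_def
        by (simp add: complex_norm_square mult.commute del: of_real_power)
      finally have "s \<le> norm w * K" using K[of w] s0 by simp
      moreover have "(norm w)\<^sup>2 = s" unfolding w_def s_def
        using norm_sum_orthonormal[OF oB F, of "\<lambda>u. cnj (f u)"] by simp
      ultimately have "norm w * norm w \<le> norm w * K" by (simp add: power2_eq_square)
      then have "norm w \<le> K \<or> norm w = 0" by (auto simp: mult_le_cancel_left)
      then have "(norm w)\<^sup>2 \<le> K\<^sup>2" by (auto intro: power_mono)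
      then show ?thesis using \<open>(norm w)\<^sup>2 = s\<close> by (simp add: s_def)
    qed
    then show "\<forall>\<^sub>F F in finite_subsets_at_top B. (\<Sum>u\<in>F. (cmod (cnj (f u)))\<^sup>2) \<le> K\<^sup>2"
      by (rule eventually_finite_subsets_at_top_weakI)
  qed simp
  then obtain z where z: "((\<lambda>u. cnj (f u) *\<^sub>C u) has_sum z) B"
    using summable_on_orthonormal[OF oB, of "\<lambda>u. cnj (f u)"]
    unfolding summable_on_def by blast
  have "f x = cinner z x" for x
  proof -
    have "((\<lambda>u. cinner x (cnj (f u) *\<^sub>C u)) has_sum cinner x z) B"
      by (rule has_sum_bounded_linear[OF bounded_linear_cinner_right z])
    then have "((\<lambda>u. cnj (cinner x (cnj (f u) *\<^sub>C u))) has_sum cnj (cinner x z)) B"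
      by (simp only: has_sum_cnj_iff)
    then have "((\<lambda>u. cinner u x * f u) has_sum cinner z x) B"
      by (simp add: cinner_scaleC_right cinner_commute[symmetric] mult.commute)
    moreover have "((\<lambda>u. cinner u x * f u) has_sum f x) B"
      using has_sum_bounded_linear[OF lin(1) has_sum_basis_expansion[OF B]] by (simp add: lin(2))
    ultimately show ?thesis using has_sum_unique by blast
  qed
  then show ?thesis by (rule that)
qed


section \<open>The Hilbert space tensor product\<close>

text \<open>
  The tensor product of Hilbert spaces \<open>H\<close> and \<open>K\<close> is realised as the space of
  antilinear Hilbert--Schmidt operators from \<open>K\<close> to \<open>H\<close>, the elementary tensor
  \<open>x \<otimes> y\<close> being the operator that maps \<open>v\<close> to \<open>\<langle>v, y\<rangle> x\<close>. The lemmas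
  \<open>cinner_tensor\<close> and \<open>tensor_expansion\<close> below show that this is the usual tensor product:
  \<open>\<langle>x \<otimes> y, x' \<otimes> y'\<rangle> = \<langle>x, x'\<rangle> \<langle>y, y'\<rangle>\<close>, and the elementary tensors are total.
\<close>

definition hilbert_schmidt :: "('b::chilbert_space \<Rightarrow> 'a::chilbert_space) \<Rightarrow> bool" where
  "hilbert_schmidt A \<longleftrightarrow> bounded_antilinear A \<and>
     (\<exists>B. orthonormal_basis B \<and> (\<lambda>u. (norm (A u))\<^sup>2) summable_on B)"

lemma has_sum_swap_nonneg:
  fixes f :: "'i \<Rightarrow> 'j \<Rightarrow> real"
  assumes nn: "\<And>x y. f x y \<ge> 0"
    and g: "\<And>x. x \<in> A \<Longrightarrow> ((\<lambda>y. f x y) has_sum g x) B"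
    and h: "\<And>y. y \<in> B \<Longrightarrow> ((\<lambda>x. f x y) has_sum h y) A"
    and S: "(g has_sum S) A"
  shows "(h has_sum S) B"
proof -
  have "(\<lambda>(x, y). f x y) summable_on A \<times> B"
    by (rule summable_on_SigmaI[where g = g]) (use assms in \<open>auto simp: summable_on_def\<close>)
  then have "((\<lambda>(x, y). f x y) has_sum S) (A \<times> B)"
    by (intro has_sum_SigmaI[where g = g]) (use assms in auto)
  then have "((\<lambda>(y, x). f x y) has_sum S) (B \<times> A)"
    by (subst (asm) has_sum_swap) (simp add: case_prod_unfold)
  then show ?thesis
    by (rule has_sum_SigmaD) (use h in auto)
qed

lemma bounded_antilinear_scaleC: "bounded_antilinear A \<Longrightarrow> A (c *\<^sub>C x) = cnj c *\<^sub>C A x"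
  by (simp add: bounded_antilinear_def)

lemma bounded_antilinear_linear: "bounded_antilinear A \<Longrightarrow> bounded_linear A"
  by (simp add: bounded_antilinear_def)

lemma hilbert_schmidt_basis_independent:
  fixes A :: "'b::chilbert_space \<Rightarrow> 'a::chilbert_space"
  assumes A: "bounded_antilinear A" and B: "orthonormal_basis B" and C: "orthonormal_basis C"
    and S: "((\<lambda>u. (norm (A u))\<^sup>2) has_sum S) B"
  shows "((\<lambda>u. (norm (A u))\<^sup>2) has_sum S) C"
proof -
  obtain D :: "'a set" where D: "orthonormal_basis D" using ex_orthonormal_basis by blast
  have "\<exists>z. \<forall>w. cinner (A w) v = cinner z w" for v
  proof -
    have "bounded_clinear (\<lambda>w. cinner (A w) v)"
      unfolding bounded_clinear_def
      using bounded_linear_compose[OF bounded_bilinear.bounded_linear_left[OF bounded_bilinear_cinner]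
          bounded_antilinear_linear[OF A]]
      by (simp add: bounded_antilinear_scaleC[OF A] cinner_scaleC_left scaleC_complex_def)
    then show ?thesis using riesz by metis
  qed
  then obtain z where z: "\<And>v w. cinner (A w) v = cinner (z v) w" by metis
  have eq: "cmod (cinner v (A w)) = cmod (cinner w (z v))" for v w
    using z[of w v] cinner_commute by (metis complex_mod_cnj)
  have ps: "((\<lambda>v. (cmod (cinner u (z v)))\<^sup>2) has_sum (norm (A u))\<^sup>2) D" for u
    using parseval_norm[OF D, of "A u"] by (simp add: eq)
  have "((\<lambda>v. (norm (z v))\<^sup>2) has_sum S) D"
    by (rule has_sum_swap_nonneg[where f = "\<lambda>u v. (cmod (cinner u (z v)))\<^sup>2", OF _ ps
          parseval_norm[OF B] S]) simp
  then show ?thesis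
    by (rule has_sum_swap_nonneg[where f = "\<lambda>v u. (cmod (cinner u (z v)))\<^sup>2", OF _
          parseval_norm[OF C] ps, rotated]) simp
qed

lemma hilbert_schmidt_summable:
  assumes "hilbert_schmidt A" "orthonormal_basis B"
  shows "(\<lambda>u. (norm (A u))\<^sup>2) summable_on B"
  using assms hilbert_schmidt_basis_independent unfolding hilbert_schmidt_def summable_on_def
  by metis

lemma bounded_antilinear_zero: "bounded_antilinear (\<lambda>_. 0)"
  by (simp add: bounded_antilinear_def bounded_linear_zero)

lemma bounded_antilinear_add:
  "bounded_antilinear A \<Longrightarrow> bounded_antilinear A' \<Longrightarrow> bounded_antilinear (\<lambda>v. A v + A' v)"
  by (simp add: bounded_antilinear_def bounded_linear_add scaleC_add_right)

lemma bounded_antilinear_cmult: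
  "bounded_antilinear A \<Longrightarrow> bounded_antilinear (\<lambda>v. c *\<^sub>C A v)"
  using bounded_linear_compose[OF bounded_linear_scaleC_right, of A c]
  by (simp add: bounded_antilinear_def scaleC_scaleC mult.commute)

lemma hilbert_schmidt_zero: "hilbert_schmidt (\<lambda>_. 0)"
  using ex_orthonormal_basis by (auto simp: hilbert_schmidt_def bounded_antilinear_zero)

lemma norm_add_sq_le: "(norm (x + y))\<^sup>2 \<le> 2 * (norm x)\<^sup>2 + 2 * (norm y)\<^sup>2"
  for x y :: "'a::real_normed_vector"
proof -
  have "(norm (x + y))\<^sup>2 \<le> (norm x + norm y)\<^sup>2" by (simp add: norm_triangle_ineq power_mono)
  also have "\<dots> \<le> 2 * (norm x)\<^sup>2 + 2 * (norm y)\<^sup>2"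
    using zero_le_power2[of "norm x - norm y"] by (simp add: power2_eq_square algebra_simps)
  finally show ?thesis .
qed

lemma hilbert_schmidt_add:
  assumes "hilbert_schmidt A" "hilbert_schmidt A'"
  shows "hilbert_schmidt (\<lambda>v. A v + A' v)"
proof -
  obtain B :: "'a set" where B: "orthonormal_basis B" using ex_orthonormal_basis by blast
  have "(\<lambda>u. 2 * (norm (A u))\<^sup>2 + 2 * (norm (A' u))\<^sup>2) summable_on B"
    using assms B by (intro summable_on_add summable_on_cmult_right hilbert_schmidt_summable)
  then have "(\<lambda>u. (norm (A u + A' u))\<^sup>2) summable_on B"
    by (rule summable_on_comparison_test) (auto simp: norm_add_sq_le)
  then show ?thesis using assms B by (auto simp: hilbert_schmidt_def bounded_antilinear_add)
qed

lemma hilbert_schmidt_cmult: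
  assumes "hilbert_schmidt A"
  shows "hilbert_schmidt (\<lambda>v. c *\<^sub>C A v)"
  using assms unfolding hilbert_schmidt_def
  by (auto simp: power_mult_distrib bounded_antilinear_cmult intro!: summable_on_cmult_right)

typedef (overloaded) ('a, 'b) htensor = "{A :: 'b::chilbert_space \<Rightarrow> 'a::chilbert_space. hilbert_schmidt A}"
  using hilbert_schmidt_zero by blast

setup_lifting type_definition_htensor

definition some_onb :: "'a::chilbert_space set" where
  "some_onb = (SOME B. orthonormal_basis B)"

lemma some_onb: "orthonormal_basis some_onb"
  unfolding some_onb_def using ex_orthonormal_basis by (rule someI_ex)

lemma hilbert_schmidt_minus:
  assumes "hilbert_schmidt A"
  shows "hilbert_schmidt (\<lambda>v. - A v)"
  using hilbert_schmidt_cmult[OF assms, of "-1"] by (simp add: scaleC_minus_left)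

lemma hilbert_schmidt_diff:
  assumes "hilbert_schmidt A" "hilbert_schmidt A'"
  shows "hilbert_schmidt (\<lambda>v. A v - A' v)"
  using hilbert_schmidt_add[OF assms(1) hilbert_schmidt_minus[OF assms(2)]] by simp

lemma hilbert_schmidt_scaleR:
  fixes A :: "'b::chilbert_space \<Rightarrow> 'a::chilbert_space"
  assumes "hilbert_schmidt A"
  shows "hilbert_schmidt (\<lambda>v. r *\<^sub>R A v)"
  using hilbert_schmidt_cmult[OF assms, of "of_real r"] by (simp add: scaleR_scaleC[where 'a='a])

definition hs_norm :: "('b::chilbert_space \<Rightarrow> 'a::chilbert_space) \<Rightarrow> real" where
  "hs_norm A = sqrt (\<Sum>\<^sub>\<infinity>u\<in>some_onb. (norm (A u))\<^sup>2)"

lemma hs_norm_has_sum: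
  assumes "hilbert_schmidt A" "orthonormal_basis B"
  shows "((\<lambda>u. (norm (A u))\<^sup>2) has_sum (hs_norm A)\<^sup>2) B"
proof -
  have "((\<lambda>u. (norm (A u))\<^sup>2) has_sum (\<Sum>\<^sub>\<infinity>u\<in>some_onb. (norm (A u))\<^sup>2)) some_onb"
    by (rule has_sum_infsum[OF hilbert_schmidt_summable[OF assms(1) some_onb]])
  moreover have "(hs_norm A)\<^sup>2 = (\<Sum>\<^sub>\<infinity>u\<in>some_onb. (norm (A u))\<^sup>2)"
    unfolding hs_norm_def by (simp add: infsum_nonneg)
  ultimately show ?thesis
    using assms hilbert_schmidt_basis_independent some_onb
    unfolding hilbert_schmidt_def by metis
qed

lemma hs_norm_nonneg: "hs_norm A \<ge> 0"
  unfolding hs_norm_def by (simp add: infsum_nonneg)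

lemma norm_apply_le_hs_norm:
  fixes A :: "'b::chilbert_space \<Rightarrow> 'a::chilbert_space"
  assumes "hilbert_schmidt A"
  shows "norm (A x) \<le> hs_norm A * norm x"
proof (cases "x = 0")
  case True
  have "bounded_linear A" using assms by (auto simp: hilbert_schmidt_def bounded_antilinear_def)
  then have "A 0 = 0" by (rule linear_0[OF bounded_linear.linear])
  then show ?thesis using True by simp
next
  case False
  define e where "e = (1 / norm x) *\<^sub>R x"
  have lin: "bounded_linear A"
    using assms by (auto simp: hilbert_schmidt_def bounded_antilinear_def)
  have "norm e = 1" using False by (simp add: e_def)
  then have "orthonormal {e}" by (simp add: orthonormal_def)
  then obtain B where B: "orthonormal_basis B" "{e} \<subseteq> B" by (rule orthonormal_extend)
  have "(\<Sum>u\<in>{e}. (norm (A u))\<^sup>2) \<le> (hs_norm A)\<^sup>2"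
    by (rule finite_sum_le_has_sum[OF hs_norm_has_sum[OF assms B(1)]]) (use B in auto)
  then have "(norm (A e))\<^sup>2 \<le> (hs_norm A)\<^sup>2" by simp
  then have "norm (A e) \<le> hs_norm A" by (rule power2_le_imp_le) (rule hs_norm_nonneg)
  moreover have "A e = (1 / norm x) *\<^sub>R A x"
    unfolding e_def by (rule linear_scale[OF bounded_linear.linear[OF lin]])
  ultimately show ?thesis using False by (simp add: pos_divide_le_eq)
qed

lemma L2_set_le_hs_norm:
  assumes "hilbert_schmidt A" "orthonormal_basis B" "finite F" "F \<subseteq> B"
  shows "L2_set (\<lambda>u. norm (A u)) F \<le> hs_norm A"
proof -
  have "(\<Sum>u\<in>F. (norm (A u))\<^sup>2) \<le> (hs_norm A)\<^sup>2"
    by (rule finite_sum_le_has_sum[OF hs_norm_has_sum[OF assms(1,2)]]) (use assms in auto)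
  then show ?thesis unfolding L2_set_def by (simp add: real_le_lsqrt hs_norm_nonneg sum_nonneg)
qed

lemma hs_norm_leI:
  assumes A: "bounded_antilinear A" and B: "orthonormal_basis B" and "K \<ge> 0"
    and le: "\<And>F. finite F \<Longrightarrow> F \<subseteq> B \<Longrightarrow> L2_set (\<lambda>u. norm (A u)) F \<le> K"
  shows "hilbert_schmidt A" "hs_norm A \<le> K"
proof -
  have le': "(\<Sum>u\<in>F. (norm (A u))\<^sup>2) \<le> K\<^sup>2" if "finite F" "F \<subseteq> B" for F
    using le[OF that] \<open>K \<ge> 0\<close> unfolding L2_set_def by (simp add: real_sqrt_le_iff' sum_nonneg)
  have "(\<lambda>u. (norm (A u))\<^sup>2) summable_on B"
    by (rule nonneg_bounded_partial_sums_imp_summable_on[where C = "K\<^sup>2"])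
       (auto intro!: eventually_finite_subsets_at_top_weakI le')
  then show hs: "hilbert_schmidt A" using A B by (auto simp: hilbert_schmidt_def)
  have "(hs_norm A)\<^sup>2 \<le> K\<^sup>2"
    by (rule has_sum_le_finite_sums[OF hs_norm_has_sum[OF hs B]]) (use le' in auto)
  then show "hs_norm A \<le> K" using \<open>K \<ge> 0\<close> by (rule power2_le_imp_le)
qed

lemma hs_norm_triangle:
  assumes A: "hilbert_schmidt A" and A': "hilbert_schmidt A'"
  shows "hs_norm (\<lambda>v. A v + A' v) \<le> hs_norm A + hs_norm A'"
proof (rule hs_norm_leI(2)[OF _ some_onb])
  show "bounded_antilinear (\<lambda>v. A v + A' v)"
    using assms by (simp add: hilbert_schmidt_def bounded_antilinear_add)
  show "0 \<le> hs_norm A + hs_norm A'" by (simp add: hs_norm_nonneg)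
  fix F :: "'a set" assume F: "finite F" "F \<subseteq> some_onb"
  have "L2_set (\<lambda>u. norm (A u + A' u)) F \<le> L2_set (\<lambda>u. norm (A u) + norm (A' u)) F"
    by (rule L2_set_mono) (auto simp: norm_triangle_ineq)
  also have "\<dots> \<le> L2_set (\<lambda>u. norm (A u)) F + L2_set (\<lambda>u. norm (A' u)) F"
    by (rule L2_set_triangle_ineq)
  also have "\<dots> \<le> hs_norm A + hs_norm A'"
    by (intro add_mono L2_set_le_hs_norm[OF _ some_onb F] A A')
  finally show "L2_set (\<lambda>u. norm (A u + A' u)) F \<le> hs_norm A + hs_norm A'" .
qed

lemma hs_norm_scaleR:
  assumes A: "hilbert_schmidt A"
  shows "hs_norm (\<lambda>v. r *\<^sub>R A v) = \<bar>r\<bar> * hs_norm A"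
proof -
  have "((\<lambda>u. r\<^sup>2 * (norm (A u))\<^sup>2) has_sum r\<^sup>2 * (hs_norm A)\<^sup>2) some_onb"
    by (intro has_sum_cmult_right hs_norm_has_sum[OF A some_onb])
  then have "((\<lambda>u. (norm (r *\<^sub>R A u))\<^sup>2) has_sum r\<^sup>2 * (hs_norm A)\<^sup>2) some_onb"
    by (simp add: power_mult_distrib)
  then have "(hs_norm (\<lambda>v. r *\<^sub>R A v))\<^sup>2 = r\<^sup>2 * (hs_norm A)\<^sup>2"
    using hs_norm_has_sum[OF hilbert_schmidt_scaleR[OF A] some_onb] has_sum_unique by blast
  then have "(hs_norm (\<lambda>v. r *\<^sub>R A v))\<^sup>2 = (\<bar>r\<bar> * hs_norm A)\<^sup>2"
    by (simp add: power_mult_distrib)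
  then show ?thesis
    by (rule power2_eq_imp_eq) (simp_all add: hs_norm_nonneg)
qed

instantiation htensor :: (chilbert_space, chilbert_space) real_vector
begin

lift_definition zero_htensor :: "('a, 'b) htensor" is "\<lambda>_. 0" by (rule hilbert_schmidt_zero)
lift_definition plus_htensor :: "('a, 'b) htensor \<Rightarrow> ('a, 'b) htensor \<Rightarrow> ('a, 'b) htensor"
  is "\<lambda>A A' v. A v + A' v" by (rule hilbert_schmidt_add)
lift_definition minus_htensor :: "('a, 'b) htensor \<Rightarrow> ('a, 'b) htensor \<Rightarrow> ('a, 'b) htensor"
  is "\<lambda>A A' v. A v - A' v" by (rule hilbert_schmidt_diff)
lift_definition uminus_htensor :: "('a, 'b) htensor \<Rightarrow> ('a, 'b) htensor"
  is "\<lambda>A v. - A v" by (rule hilbert_schmidt_minus)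
lift_definition scaleR_htensor :: "real \<Rightarrow> ('a, 'b) htensor \<Rightarrow> ('a, 'b) htensor"
  is "\<lambda>r A v. r *\<^sub>R A v" by (rule hilbert_schmidt_scaleR)

instance
proof
  fix R S T :: "('a, 'b) htensor" and a b :: real
  show "R + S + T = R + (S + T)" by transfer (simp add: add.assoc)
  show "S + T = T + S" by transfer (simp add: add.commute)
  show "0 + T = T" by transfer simp
  show "- T + T = 0" by transfer simp
  show "S - T = S + - T" by transfer simp
  show "a *\<^sub>R (S + T) = a *\<^sub>R S + a *\<^sub>R T" by transfer (simp add: scaleR_add_right)
  show "(a + b) *\<^sub>R T = a *\<^sub>R T + b *\<^sub>R T" by transfer (simp add: scaleR_add_left)
  show "a *\<^sub>R b *\<^sub>R T = (a * b) *\<^sub>R T" by transfer simp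
  show "1 *\<^sub>R T = T" by transfer simp
qed

end

instantiation htensor :: (chilbert_space, chilbert_space) real_normed_vector
begin

lift_definition norm_htensor :: "('a, 'b) htensor \<Rightarrow> real" is hs_norm .

definition dist_htensor :: "('a, 'b) htensor \<Rightarrow> ('a, 'b) htensor \<Rightarrow> real" where
  "dist_htensor S T = norm (S - T)"
definition sgn_htensor :: "('a, 'b) htensor \<Rightarrow> ('a, 'b) htensor" where
  "sgn_htensor T = T /\<^sub>R norm T"
definition uniformity_htensor :: "(('a, 'b) htensor \<times> ('a, 'b) htensor) filter" where
  "uniformity_htensor = (INF e\<in>{0<..}. principal {(S, T). dist S T < e})"
definition open_htensor :: "('a, 'b) htensor set \<Rightarrow> bool" where
  "open_htensor U \<longleftrightarrow> (\<forall>S\<in>U. \<forall>\<^sub>F (S', T) in uniformity. S' = S \<longrightarrow> T \<in> U)"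

instance
proof
  fix S T :: "('a, 'b) htensor" and a :: real and U :: "('a, 'b) htensor set"
  show "dist S T = norm (S - T)" by (rule dist_htensor_def)
  show "sgn T = T /\<^sub>R norm T" by (rule sgn_htensor_def)
  show "uniformity = (INF e\<in>{0<..}. principal {(S :: ('a, 'b) htensor, T). dist S T < e})"
    by (rule uniformity_htensor_def)
  show "open U = (\<forall>S\<in>U. \<forall>\<^sub>F (S', T) in uniformity. S' = S \<longrightarrow> T \<in> U)"
    by (rule open_htensor_def)
  show "norm (S + T) \<le> norm S + norm T" by transfer (rule hs_norm_triangle)
  show "norm (a *\<^sub>R T) = \<bar>a\<bar> * norm T" by transfer (rule hs_norm_scaleR)
  show "norm T = 0 \<longleftrightarrow> T = 0"
  proof transfer
    fix A :: "'b \<Rightarrow> 'a" assume A: "hilbert_schmidt A"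
    show "hs_norm A = 0 \<longleftrightarrow> A = (\<lambda>_. 0)"
    proof
      assume "hs_norm A = 0"
      then show "A = (\<lambda>_. 0)" using norm_apply_le_hs_norm[OF A] by (auto simp: fun_eq_iff)
    next
      assume "A = (\<lambda>_. 0)"
      then show "hs_norm A = 0" by (simp add: hs_norm_def)
    qed
  qed
qed

end

lemma hilbert_schmidt_Rep: "hilbert_schmidt (Rep_htensor T)"
  using Rep_htensor by blast

lemma bounded_antilinear_Rep: "bounded_antilinear (Rep_htensor T)"
  using hilbert_schmidt_Rep by (auto simp: hilbert_schmidt_def)

lemma norm_htensor_has_sum:
  "orthonormal_basis B \<Longrightarrow> ((\<lambda>u. (norm (Rep_htensor T u))\<^sup>2) has_sum (norm T)\<^sup>2) B"
  using hs_norm_has_sum[OF hilbert_schmidt_Rep] by (simp add: norm_htensor.rep_eq)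

lemma norm_Rep_htensor_le: "norm (Rep_htensor T x) \<le> norm T * norm x"
  using norm_apply_le_hs_norm[OF hilbert_schmidt_Rep] by (simp add: norm_htensor.rep_eq)

lemma polarization:
  fixes x y :: "'a::chilbert_space"
  shows "cinner x y = of_real ((norm (x + y))\<^sup>2 - (norm (x - y))\<^sup>2) / 4
    + \<i> * of_real ((norm (\<i> *\<^sub>C x + y))\<^sup>2 - (norm (\<i> *\<^sub>C x - y))\<^sup>2) / 4"
proof -
  have *: "(norm (a + b))\<^sup>2 - (norm (a - b))\<^sup>2 = 4 * Re (cinner a b)" for a b :: 'a
    using arg_cong[OF cinner_commute[of b a], of Re]
    by (simp add: norm_sq_cinner cinner_add_left cinner_add_right cinner_diff_left cinner_diff_right)
  show ?thesis unfolding * by (simp add: cinner_scaleC_left complex_eq_iff)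
qed

instantiation htensor :: (chilbert_space, chilbert_space) chilbert_space
begin

lift_definition scaleC_htensor :: "complex \<Rightarrow> ('a, 'b) htensor \<Rightarrow> ('a, 'b) htensor"
  is "\<lambda>c A v. c *\<^sub>C A v" by (rule hilbert_schmidt_cmult)

definition cinner_htensor :: "('a, 'b) htensor \<Rightarrow> ('a, 'b) htensor \<Rightarrow> complex" where
  "cinner_htensor S T = (\<Sum>\<^sub>\<infinity>u\<in>some_onb. cinner (Rep_htensor S u) (Rep_htensor T u))"

lemma cinner_htensor_summable:
  fixes S T :: "('a, 'b) htensor"
  assumes "orthonormal_basis B"
  shows "(\<lambda>u. cinner (Rep_htensor S u) (Rep_htensor T u)) summable_on B"
proof (rule abs_summable_summable, rule Infinite_Sum.abs_summable_on_comparison_test')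
  show "(\<lambda>u. (norm (Rep_htensor S u))\<^sup>2 + (norm (Rep_htensor T u))\<^sup>2) summable_on B"
    using assms by (intro summable_on_add hilbert_schmidt_summable hilbert_schmidt_Rep)
  fix u
  show "cmod (cinner (Rep_htensor S u) (Rep_htensor T u))
      \<le> (norm (Rep_htensor S u))\<^sup>2 + (norm (Rep_htensor T u))\<^sup>2" (is "_ \<le> ?a\<^sup>2 + ?b\<^sup>2")
  proof (rule order_trans[OF norm_cinner_le])
    have "2 * (?a * ?b) \<le> ?a\<^sup>2 + ?b\<^sup>2"
      using zero_le_power2[of "?a - ?b"] by (simp add: power2_eq_square algebra_simps)
    moreover have "?a * ?b \<ge> 0" by simp
    ultimately show "?a * ?b \<le> ?a\<^sup>2 + ?b\<^sup>2" by linarith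
  qed
qed

lemma cinner_htensor_some_onb:
  fixes S T :: "('a, 'b) htensor"
  shows "((\<lambda>u. cinner (Rep_htensor S u) (Rep_htensor T u)) has_sum cinner S T) some_onb"
  unfolding cinner_htensor_def by (rule has_sum_infsum[OF cinner_htensor_summable[OF some_onb]])

instance
proof
  fix R S T :: "('a, 'b) htensor" and a b :: complex and r :: real
  show "a *\<^sub>C (S + T) = a *\<^sub>C S + a *\<^sub>C T" by transfer (simp add: scaleC_add_right)
  show "(a + b) *\<^sub>C T = a *\<^sub>C T + b *\<^sub>C T" by transfer (simp add: scaleC_add_left)
  show "a *\<^sub>C b *\<^sub>C T = (a * b) *\<^sub>C T" by transfer (simp add: scaleC_scaleC)
  show "r *\<^sub>R T = complex_of_real r *\<^sub>C T" by transfer (simp add: scaleR_scaleC[where 'a='a])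
  have "((\<lambda>u. cnj (cinner (Rep_htensor S u) (Rep_htensor T u))) has_sum cnj (cinner S T)) some_onb"
    using cinner_htensor_some_onb by (simp only: has_sum_cnj_iff)
  then have "((\<lambda>u. cinner (Rep_htensor T u) (Rep_htensor S u)) has_sum cnj (cinner S T)) some_onb"
    by (simp add: cinner_commute[symmetric])
  then show "cinner T S = cnj (cinner S T)"
    using cinner_htensor_some_onb has_sum_unique by blast
  show "cinner R (S + T) = cinner R S + cinner R T"
    using has_sum_add[OF cinner_htensor_some_onb[of R S] cinner_htensor_some_onb[of R T]]
      cinner_htensor_some_onb[of R "S + T"]
    by (simp add: plus_htensor.rep_eq cinner_add_right has_sum_unique)
  show "cinner S (a *\<^sub>C T) = a * cinner S T"
    using has_sum_cmult_right[OF cinner_htensor_some_onb[of S T], of a]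
      cinner_htensor_some_onb[of S "a *\<^sub>C T"]
    by (simp add: scaleC_htensor.rep_eq cinner_scaleC_right has_sum_unique)
  have "((\<lambda>u. complex_of_real ((norm (Rep_htensor T u))\<^sup>2)) has_sum of_real ((norm T)\<^sup>2)) some_onb"
    by (rule has_sum_of_real[OF norm_htensor_has_sum[OF some_onb]])
  then have "((\<lambda>u. cinner (Rep_htensor T u) (Rep_htensor T u)) has_sum of_real ((norm T)\<^sup>2)) some_onb"
    by (simp only: cinner_eq_norm)
  then show "cinner T T = complex_of_real ((norm T)\<^sup>2)"
    using cinner_htensor_some_onb has_sum_unique by blast
next
  fix X :: "nat \<Rightarrow> ('a, 'b) htensor" assume X: "Cauchy X"
  define A where "A n = Rep_htensor (X n)" for n
  have lin: "bounded_linear (A n)" for n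
    unfolding A_def by (rule bounded_antilinear_linear[OF bounded_antilinear_Rep])
  have diff: "norm (A n x - A m x) \<le> norm (X n - X m) * norm x" for n m x
    using norm_Rep_htensor_le[of "X n - X m" x] by (simp add: A_def minus_htensor.rep_eq)
  have "Cauchy (\<lambda>n. A n x)" for x
  proof (rule metric_CauchyI)
    fix e :: real assume "e > 0"
    then have "e / (norm x + 1) > 0" by (simp add: add_nonneg_pos)
    then obtain N where N: "\<And>n m. n \<ge> N \<Longrightarrow> m \<ge> N \<Longrightarrow> dist (X n) (X m) < e / (norm x + 1)"
      using metric_CauchyD[OF X] by metis
    have "dist (A n x) (A m x) < e" if "n \<ge> N" "m \<ge> N" for n m
    proof -
      have "norm (X n - X m) * (norm x + 1) < e"
        using N[OF that] by (simp add: dist_norm pos_less_divide_eq add_nonneg_pos)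
      moreover have "norm (X n - X m) * norm x \<le> norm (X n - X m) * (norm x + 1)"
        by (intro mult_left_mono) auto
      ultimately show ?thesis using diff[of n x m] by (simp add: dist_norm)
    qed
    then show "\<exists>M. \<forall>m\<ge>M. \<forall>n\<ge>M. dist (A m x) (A n x) < e" by blast
  qed
  then have "\<forall>x. \<exists>l. (\<lambda>n. A n x) \<longlonglongrightarrow> l" by (simp add: Cauchy_convergent_iff convergent_def)
  then obtain L where L: "\<And>x. (\<lambda>n. A n x) \<longlonglongrightarrow> L x" by metis
  obtain M where M: "\<And>n. norm (X n) \<le> M"
    using Cauchy_Bseq[OF X] by (auto simp: Bseq_def)
  have bL: "bounded_antilinear L"
    unfolding bounded_antilinear_def
  proof (intro conjI allI bounded_linear_intro[where K = M])
    fix x y :: 'b and r :: real and c :: complex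
    have "(\<lambda>n. A n (x + y)) \<longlonglongrightarrow> L x + L y"
      using tendsto_add[OF L[of x] L[of y]]
      by (simp add: linear_add[OF bounded_linear.linear[OF lin]])
    then show "L (x + y) = L x + L y" using L LIMSEQ_unique by blast
    have "(\<lambda>n. A n (r *\<^sub>R x)) \<longlonglongrightarrow> r *\<^sub>R L x"
      using tendsto_scaleR[OF tendsto_const L[of x]]
      by (simp add: linear_scale[OF bounded_linear.linear[OF lin]])
    then show "L (r *\<^sub>R x) = r *\<^sub>R L x" using L LIMSEQ_unique by blast
    have "(\<lambda>n. A n (c *\<^sub>C x)) \<longlonglongrightarrow> cnj c *\<^sub>C L x"
      using tendsto_scaleC[OF tendsto_const L[of x]]
      by (simp add: A_def bounded_antilinear_scaleC[OF bounded_antilinear_Rep])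
    then show "L (c *\<^sub>C x) = cnj c *\<^sub>C L x" using L LIMSEQ_unique by blast
    show "norm (L x) \<le> norm x * M"
    proof (rule tendsto_upperbound[OF tendsto_norm[OF L[of x]]])
      have "norm (A n x) \<le> norm x * M" for n
        using norm_Rep_htensor_le[of "X n" x] mult_right_mono[OF M[of n], of "norm x"]
        by (simp add: A_def mult.commute)
      then show "\<forall>\<^sub>F n in sequentially. norm (A n x) \<le> norm x * M" by simp
    qed simp
  qed
  have close: "\<exists>N. \<forall>n\<ge>N. hilbert_schmidt (\<lambda>v. A n v - L v) \<and> hs_norm (\<lambda>v. A n v - L v) \<le> e"
    if "e > 0" for e
  proof -
    obtain N where N: "\<And>n m. n \<ge> N \<Longrightarrow> m \<ge> N \<Longrightarrow> dist (X n) (X m) < e"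
      using metric_CauchyD[OF X \<open>e > 0\<close>] by metis
    have "hilbert_schmidt (\<lambda>v. A n v - L v) \<and> hs_norm (\<lambda>v. A n v - L v) \<le> e" if "n \<ge> N" for n
    proof -
      have b: "bounded_antilinear (\<lambda>v. A n v - L v)"
        using bounded_antilinear_add[OF bounded_antilinear_Rep[of "X n"]
            bounded_antilinear_cmult[OF bL, of "-1"]]
        by (simp add: A_def scaleC_minus_left)
      have le: "L2_set (\<lambda>u. norm (A n u - L u)) F \<le> e" if F: "finite F" "F \<subseteq> some_onb" for F
      proof (rule tendsto_upperbound)
        show "(\<lambda>m. L2_set (\<lambda>u. norm (A n u - A m u)) F) \<longlonglongrightarrow> L2_set (\<lambda>u. norm (A n u - L u)) F"
          unfolding L2_set_def by (intro tendsto_intros L)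
        have "L2_set (\<lambda>u. norm (A n u - A m u)) F \<le> e" if "m \<ge> N" for m
        proof -
          have "L2_set (\<lambda>u. norm (A n u - A m u)) F \<le> norm (X n - X m)"
            using L2_set_le_hs_norm[OF hilbert_schmidt_Rep[of "X n - X m"] some_onb F]
            by (simp add: A_def minus_htensor.rep_eq norm_htensor.rep_eq)
          then show ?thesis using N[OF \<open>n \<ge> N\<close> that] by (simp add: dist_norm)
        qed
        then show "\<forall>\<^sub>F m in sequentially. L2_set (\<lambda>u. norm (A n u - A m u)) F \<le> e"
          by (auto simp: eventually_sequentially)
      qed simp
      show ?thesis using hs_norm_leI[OF b some_onb _ le] \<open>e > 0\<close> by simp
    qed
    then show ?thesis by blast
  qed
  obtain N1 where "hilbert_schmidt (\<lambda>v. A N1 v - L v)" using close[of 1] by auto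
  from hilbert_schmidt_diff[OF hilbert_schmidt_Rep[of "X N1"] this]
  have hL: "hilbert_schmidt L" by (simp add: A_def)
  have Rep: "Rep_htensor (Abs_htensor L) = L" using hL by (simp add: Abs_htensor_inverse)
  have "X \<longlonglongrightarrow> Abs_htensor L"
  proof (rule metric_LIMSEQ_I)
    fix e :: real assume "e > 0"
    then obtain N where N: "\<And>n. n \<ge> N \<Longrightarrow> hs_norm (\<lambda>v. A n v - L v) \<le> e / 2"
      using close[of "e / 2"] by auto
    have "dist (X n) (Abs_htensor L) < e" if "n \<ge> N" for n
      using N[OF that] \<open>e > 0\<close>
      by (simp add: dist_norm norm_htensor.rep_eq minus_htensor.rep_eq Rep A_def)
    then show "\<exists>no. \<forall>n\<ge>no. dist (X n) (Abs_htensor L) < e" by blast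
  qed
  then show "convergent X" by (auto simp: convergent_def)
qed

end

lemma cinner_htensor_has_sum:
  fixes S T :: "('a::chilbert_space, 'b::chilbert_space) htensor"
  assumes B: "orthonormal_basis B"
  shows "((\<lambda>u. cinner (Rep_htensor S u) (Rep_htensor T u)) has_sum cinner S T) B"
proof -
  note n = norm_htensor_has_sum[OF B]
  have d: "((\<lambda>u. (norm (Rep_htensor S' u + Rep_htensor T u))\<^sup>2 - (norm (Rep_htensor S' u - Rep_htensor T u))\<^sup>2)
      has_sum (norm (S' + T))\<^sup>2 - (norm (S' - T))\<^sup>2) B" for S' :: "('a, 'b) htensor"
    using has_sum_add[OF n[of "S' + T"] has_sum_uminusI[OF n[of "S' - T"]]]
    by (simp add: plus_htensor.rep_eq minus_htensor.rep_eq)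
  have p: "cinner x y = 1 / 4 * of_real ((norm (x + y))\<^sup>2 - (norm (x - y))\<^sup>2)
      + \<i> / 4 * of_real ((norm (\<i> *\<^sub>C x + y))\<^sup>2 - (norm (\<i> *\<^sub>C x - y))\<^sup>2)"
    for x y :: "'c::chilbert_space"
    by (subst polarization) (simp del: of_real_diff of_real_power)
  show ?thesis
    unfolding p
    using has_sum_add[OF has_sum_cmult_right[OF has_sum_of_real[OF d[of S]], of "1 / 4"]
        has_sum_cmult_right[OF has_sum_of_real[OF d[of "\<i> *\<^sub>C S"]], of "\<i> / 4"]]
    unfolding scaleC_htensor.rep_eq .
qed

definition tensor :: "'a::chilbert_space \<Rightarrow> 'b::chilbert_space \<Rightarrow> ('a, 'b) htensor" where
  "tensor x y = Abs_htensor (\<lambda>v. cinner v y *\<^sub>C x)"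

lemma Rep_tensor: "Rep_htensor (tensor x y) = (\<lambda>v. cinner v y *\<^sub>C x)"
proof -
  have "bounded_linear (\<lambda>v. cinner v y *\<^sub>C x)"
    by (rule bounded_linear_compose[OF bounded_linear_scaleC_left
          bounded_bilinear.bounded_linear_left[OF bounded_bilinear_cinner]])
  then have "bounded_antilinear (\<lambda>v. cinner v y *\<^sub>C x)"
    by (simp add: bounded_antilinear_def cinner_scaleC_left scaleC_scaleC)
  moreover have "(\<lambda>u. (norm (cinner u y *\<^sub>C x))\<^sup>2) summable_on some_onb"
    using has_sum_imp_summable[OF has_sum_cmult_left[OF parseval_norm[OF some_onb, of y], of "(norm x)\<^sup>2"]]
    by (simp add: power_mult_distrib)
  ultimately have "hilbert_schmidt (\<lambda>v. cinner v y *\<^sub>C x)"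
    using some_onb by (auto simp: hilbert_schmidt_def)
  then show ?thesis by (simp add: tensor_def Abs_htensor_inverse)
qed

lemma cinner_tensor_left: "cinner (tensor x y) T = cinner x (Rep_htensor T y)"
proof -
  have "((\<lambda>u. cinner x (Rep_htensor T (cinner u y *\<^sub>C u))) has_sum cinner x (Rep_htensor T y)) some_onb"
    by (intro has_sum_bounded_linear[OF bounded_linear_cinner_right]
        has_sum_bounded_linear[OF bounded_antilinear_linear[OF bounded_antilinear_Rep]]
        has_sum_basis_expansion some_onb)
  moreover have "((\<lambda>u. cinner x (Rep_htensor T (cinner u y *\<^sub>C u))) has_sum cinner (tensor x y) T) some_onb"
    using cinner_htensor_has_sum[OF some_onb, of "tensor x y" T]
    by (simp add: Rep_tensor bounded_antilinear_scaleC[OF bounded_antilinear_Rep]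
        cinner_scaleC_right cinner_scaleC_left)
  ultimately show ?thesis using has_sum_unique by blast
qed

lemma cinner_tensor: "cinner (tensor x y) (tensor x' y') = cinner x x' * cinner y y'"
  by (simp only: cinner_tensor_left Rep_tensor cinner_scaleC_right mult.commute)

lemma tensor_total:
  assumes "\<And>x y. cinner (tensor x y) T = 0"
  shows "T = 0"
proof -
  have "Rep_htensor T y = 0" for y
    using assms[of "Rep_htensor T y" y] by (simp add: cinner_tensor_left)
  then show ?thesis by (simp add: Rep_htensor_inject[symmetric] zero_htensor.rep_eq fun_eq_iff)
qed

lemma bounded_bilinear_tensor:
  "bounded_bilinear (tensor :: 'a::chilbert_space \<Rightarrow> 'b::chilbert_space \<Rightarrow> ('a, 'b) htensor)"
proof
  fix x x' :: 'a and y y' :: 'b and r :: real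
  show "tensor (x + x') y = tensor x y + tensor x' y"
    by (simp add: Rep_htensor_inject[symmetric] Rep_tensor plus_htensor.rep_eq scaleC_add_right)
  show "tensor x (y + y') = tensor x y + tensor x y'"
    by (simp add: Rep_htensor_inject[symmetric] Rep_tensor plus_htensor.rep_eq cinner_add_right
        scaleC_add_left)
  show "tensor (r *\<^sub>R x) y = r *\<^sub>R tensor x y"
    by (simp add: Rep_htensor_inject[symmetric] Rep_tensor scaleR_htensor.rep_eq
        scaleR_scaleC[where 'a='a] scaleC_scaleC mult.commute)
  show "tensor x (r *\<^sub>R y) = r *\<^sub>R tensor x y"
    by (simp add: Rep_htensor_inject[symmetric] Rep_tensor scaleR_htensor.rep_eq
        scaleR_scaleC[where 'a='a] scaleR_scaleC[where 'a='b] scaleC_scaleC cinner_scaleC_right)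
  have "norm (tensor x y) = norm x * norm y" for x :: 'a and y :: 'b
  proof -
    have "cinner (tensor x y) (tensor x y) = of_real ((norm x * norm y)\<^sup>2)"
      unfolding cinner_tensor cinner_eq_norm[of x] cinner_eq_norm[of y]
      by (simp add: power_mult_distrib)
    then show ?thesis unfolding norm_eq_sqrt_cinner[of "tensor x y"]
      by (simp only: Re_complex_of_real real_sqrt_abs) simp
  qed
  then show "\<exists>K. \<forall>(x :: 'a) (y :: 'b). norm (tensor x y) \<le> norm x * norm y * K"
    by (intro exI[of _ 1]) simp
qed

lemma Rep_htensor_sum: "Rep_htensor (sum f F) v = (\<Sum>i\<in>F. Rep_htensor (f i) v)"
  by (induction F rule: infinite_finite_induct) (auto simp: zero_htensor.rep_eq plus_htensor.rep_eq)

lemma tensor_expansion: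
  fixes T :: "('a::chilbert_space, 'b::chilbert_space) htensor"
  assumes B: "orthonormal_basis B"
  shows "((\<lambda>u. tensor (Rep_htensor T u) u) has_sum T) B"
  unfolding has_sum_def
proof (rule tendstoI)
  fix e :: real assume e: "e > 0"
  have oB: "orthonormal B" using B by (simp add: orthonormal_basis_def)
  have rest: "(dist (\<Sum>u\<in>F. tensor (Rep_htensor T u) u) T)\<^sup>2
      = (norm T)\<^sup>2 - (\<Sum>u\<in>F. (norm (Rep_htensor T u))\<^sup>2)" if F: "finite F" "F \<subseteq> B" for F
  proof -
    define D where "D = T - (\<Sum>u\<in>F. tensor (Rep_htensor T u) u)"
    have D: "Rep_htensor D v = (if v \<in> F then 0 else Rep_htensor T v)" if "v \<in> B" for v
    proof -
      have "(\<Sum>u\<in>F. cinner v u *\<^sub>C Rep_htensor T u) = (\<Sum>u\<in>F. if v = u then Rep_htensor T u else 0)"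
        using F that oB by (intro sum.cong refl) (auto simp: orthonormal_cinner subset_iff)
      also have "\<dots> = (if v \<in> F then Rep_htensor T v else 0)" using F by simp
      finally show ?thesis
        by (simp add: D_def minus_htensor.rep_eq Rep_htensor_sum Rep_tensor)
    qed
    have "((\<lambda>v. (norm (Rep_htensor T v))\<^sup>2) has_sum (norm T)\<^sup>2 - (\<Sum>u\<in>F. (norm (Rep_htensor T u))\<^sup>2))
        (B - F)"
      by (rule has_sum_Diff[OF norm_htensor_has_sum[OF B] has_sum_finite[OF F(1)] F(2)])
    moreover have "((\<lambda>v. (norm (Rep_htensor D v))\<^sup>2) has_sum (norm D)\<^sup>2) B
        \<longleftrightarrow> ((\<lambda>v. (norm (Rep_htensor T v))\<^sup>2) has_sum (norm D)\<^sup>2) (B - F)"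
      by (rule has_sum_cong_neutral) (auto simp: D)
    ultimately have "(norm D)\<^sup>2 = (norm T)\<^sup>2 - (\<Sum>u\<in>F. (norm (Rep_htensor T u))\<^sup>2)"
      using norm_htensor_has_sum[OF B, of D] has_sum_unique by blast
    then show ?thesis by (simp add: dist_norm norm_minus_commute D_def)
  qed
  have "(sum (\<lambda>u. (norm (Rep_htensor T u))\<^sup>2) \<longlongrightarrow> (norm T)\<^sup>2) (finite_subsets_at_top B)"
    using norm_htensor_has_sum[OF B, of T] by (simp add: has_sum_def)
  from tendstoD[OF this, of "e\<^sup>2"] e
  have "\<forall>\<^sub>F F in finite_subsets_at_top B. dist (\<Sum>u\<in>F. (norm (Rep_htensor T u))\<^sup>2) ((norm T)\<^sup>2) < e\<^sup>2"
    by simp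
  moreover have "\<forall>\<^sub>F F in finite_subsets_at_top B. finite F \<and> F \<subseteq> B"
    by (rule eventually_finite_subsets_at_top_weakI) simp
  ultimately show "\<forall>\<^sub>F F in finite_subsets_at_top B. dist (\<Sum>u\<in>F. tensor (Rep_htensor T u) u) T < e"
  proof eventually_elim
    case (elim F)
    then have "(dist (\<Sum>u\<in>F. tensor (Rep_htensor T u) u) T)\<^sup>2 < e\<^sup>2"
      using rest[of F] by (auto simp: dist_real_def)
    then show ?case by (rule power_less_imp_less_base) (use e in simp)
  qed
qed


section \<open>Unitary representations\<close>

text \<open>
  The library class of (not necessarily commutative) topological groups is written additively:
  \<open>s + t\<close> is the product in the group and \<open>- s\<close> the inverse of \<open>s\<close>.
\<close>

definition unitary :: "('a::chilbert_space \<Rightarrow> 'a) \<Rightarrow> bool" where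
  "unitary U \<longleftrightarrow> bounded_clinear U \<and> surj U \<and> (\<forall>x y. cinner (U x) (U y) = cinner x y)"

definition unitary_rep :: "('g::topological_group_add \<Rightarrow> 'a::chilbert_space \<Rightarrow> 'a) \<Rightarrow> bool" where
  "unitary_rep \<pi> \<longleftrightarrow> (\<forall>s. unitary (\<pi> s)) \<and> (\<forall>s t. \<pi> (s + t) = \<pi> s \<circ> \<pi> t) \<and>
     (\<forall>x. continuous_on UNIV (\<lambda>s. \<pi> s x))"

text \<open>
  On operators \<open>T\<close> from \<open>K\<close> to \<open>H\<close>, \<open>\<rho> \<otimes> \<pi>\<close> acts by \<open>T \<mapsto> \<rho>(s) T \<pi>(s)\<^sup>-\<^sup>1\<close>;
  see \<open>tensor_rep_tensor\<close> for its action on elementary tensors.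
\<close>

definition tensor_rep ::
  "('g::topological_group_add \<Rightarrow> 'a::chilbert_space \<Rightarrow> 'a) \<Rightarrow> ('g \<Rightarrow> 'b::chilbert_space \<Rightarrow> 'b) \<Rightarrow>
    'g \<Rightarrow> ('a, 'b) htensor \<Rightarrow> ('a, 'b) htensor" where
  "tensor_rep \<rho> \<pi> s T = Abs_htensor (\<rho> s \<circ> Rep_htensor T \<circ> \<pi> (- s))"

lemma unitary_rep_zero: "unitary_rep \<pi> \<Longrightarrow> \<pi> 0 x = x"
proof -
  assume "unitary_rep \<pi>"
  then have s: "surj (\<pi> 0)" and a: "\<pi> (0 + 0) = \<pi> 0 \<circ> \<pi> 0"
    unfolding unitary_rep_def unitary_def by blast+
  obtain y where "x = \<pi> 0 y" using s by blast
  then show ?thesis using fun_cong[OF a, of y] by simp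
qed

lemma unitary_rep_adjoint:
  assumes "unitary_rep \<pi>"
  shows "cinner (\<pi> (- s) x) y = cinner x (\<pi> s y)"
proof -
  have "cinner (\<pi> (- s) x) y = cinner (\<pi> s (\<pi> (- s) x)) (\<pi> s y)"
    using assms by (simp add: unitary_rep_def unitary_def)
  also have "\<pi> s (\<pi> (- s) x) = \<pi> (s + - s) x"
    using assms unfolding unitary_rep_def by (metis comp_apply)
  finally show ?thesis by (simp add: unitary_rep_zero[OF assms])
qed

lemma orthonormal_basis_unitary:
  assumes U: "unitary U" and B: "orthonormal_basis B"
  shows "orthonormal_basis (U ` B)" "inj_on U B"
proof -
  have c: "cinner (U x) (U y) = cinner x y" for x y using U by (simp add: unitary_def)
  have n: "norm (U x) = norm x" for x by (simp add: norm_eq_sqrt_cinner c)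
  show "inj_on U B"
  proof (rule inj_onI)
    fix x y assume "U x = U y"
    moreover have "U (x - y) = U x - U y"
      using U by (simp add: unitary_def bounded_clinear_def bounded_linear.linear linear_diff)
    ultimately show "x = y" using n[of "x - y"] by simp
  qed
  show "orthonormal_basis (U ` B)"
    unfolding orthonormal_basis_def orthonormal_def
  proof (intro conjI allI impI ballI)
    fix x assume x: "\<forall>u\<in>U ` B. cinner u x = 0"
    obtain y where "x = U y" using U unfolding unitary_def by (metis surjD)
    with x have "\<forall>u\<in>B. cinner u y = 0" by (simp add: c)
    then have "y = 0" using B unfolding orthonormal_basis_def by blast
    then show "x = 0" using n[of y] \<open>x = U y\<close> by simp
  next
    fix u v assume "u \<in> U ` B" "v \<in> U ` B" "u \<noteq> v"
    then obtain u' v' where "u' \<in> B" "v' \<in> B" "u = U u'" "v = U v'" by blast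
    then show "cinner u v = 0"
      using B \<open>u \<noteq> v\<close> by (auto simp: c orthonormal_basis_def orthonormal_def)
  qed (use B in \<open>auto simp: n orthonormal_basis_def orthonormal_def\<close>)
qed

lemma Rep_tensor_rep:
  fixes \<rho> :: "'g::topological_group_add \<Rightarrow> 'a::chilbert_space \<Rightarrow> 'a"
    and \<pi> :: "'g \<Rightarrow> 'b::chilbert_space \<Rightarrow> 'b"
  assumes \<rho>: "unitary_rep \<rho>" and \<pi>: "unitary_rep \<pi>"
  shows "Rep_htensor (tensor_rep \<rho> \<pi> s T) = \<rho> s \<circ> Rep_htensor T \<circ> \<pi> (- s)"
proof -
  have us: "unitary (\<rho> s)" "unitary (\<pi> (- s))" using \<rho> \<pi> by (auto simp: unitary_rep_def)
  have n: "norm (\<rho> s x) = norm x" for x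
    using us by (simp add: norm_eq_sqrt_cinner unitary_def)
  have "bounded_antilinear (\<rho> s \<circ> Rep_htensor T \<circ> \<pi> (- s))"
    using us bounded_antilinear_Rep[of T]
    unfolding unitary_def bounded_clinear_def bounded_antilinear_def
    by (auto simp: o_def intro: bounded_linear_compose)
  moreover have "(\<lambda>u. (norm ((\<rho> s \<circ> Rep_htensor T \<circ> \<pi> (- s)) u))\<^sup>2) summable_on some_onb"
  proof -
    note o = orthonormal_basis_unitary[OF us(2) some_onb]
    have "(\<lambda>u. (norm (Rep_htensor T u))\<^sup>2) summable_on \<pi> (- s) ` some_onb"
      by (rule hilbert_schmidt_summable[OF hilbert_schmidt_Rep o(1)])
    then show ?thesis by (simp add: summable_on_reindex[OF o(2)] o_def n)
  qed
  ultimately have "hilbert_schmidt (\<rho> s \<circ> Rep_htensor T \<circ> \<pi> (- s))"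
    using some_onb by (auto simp: hilbert_schmidt_def)
  then show ?thesis by (simp add: tensor_rep_def Abs_htensor_inverse)
qed

lemma tensor_rep_tensor:
  assumes "unitary_rep \<rho>" "unitary_rep \<pi>"
  shows "tensor_rep \<rho> \<pi> s (tensor x y) = tensor (\<rho> s x) (\<pi> s y)"
proof -
  have "\<rho> s (c *\<^sub>C z) = c *\<^sub>C \<rho> s z" for c z
    using assms(1) by (simp add: unitary_rep_def unitary_def bounded_clinear_def)
  then show ?thesis
    by (simp add: Rep_htensor_inject[symmetric] Rep_tensor_rep[OF assms] Rep_tensor fun_eq_iff
        unitary_rep_adjoint[OF assms(2)])
qed

lemma unitary_rep_tensor_rep:
  fixes \<rho> :: "'g::topological_group_add \<Rightarrow> 'a::chilbert_space \<Rightarrow> 'a"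
    and \<pi> :: "'g \<Rightarrow> 'b::chilbert_space \<Rightarrow> 'b"
  assumes \<rho>: "unitary_rep \<rho>" and \<pi>: "unitary_rep \<pi>"
  shows "unitary_rep (tensor_rep \<rho> \<pi>)"
proof -
  let ?\<sigma> = "tensor_rep \<rho> \<pi>"
  note Rep = Rep_tensor_rep[OF \<rho> \<pi>]
  have u: "unitary (\<rho> s)" "unitary (\<pi> s)" for s using \<rho> \<pi> by (auto simp: unitary_rep_def)
  have hom: "\<rho> (s + t) x = \<rho> s (\<rho> t x)" "\<pi> (s + t) y = \<pi> s (\<pi> t y)" for s t x y
    using \<rho> \<pi> by (simp_all add: unitary_rep_def)
  have lin: "\<rho> s (x + y) = \<rho> s x + \<rho> s y" "\<rho> s (c *\<^sub>C x) = c *\<^sub>C \<rho> s x"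
      "\<rho> s (r *\<^sub>R x) = r *\<^sub>R \<rho> s x" for s x y c r
    using u(1)[of s] linear_add[OF bounded_linear.linear] linear_scale[OF bounded_linear.linear]
    unfolding unitary_def bounded_clinear_def by blast+
  have hom\<sigma>: "?\<sigma> (s + t) T = ?\<sigma> s (?\<sigma> t T)" for s t T
    using hom(2)[of "- t" "- s"]
    by (simp add: Rep_htensor_inject[symmetric] Rep fun_eq_iff hom minus_add)
  have zero: "?\<sigma> 0 T = T" for T
    by (simp add: Rep_htensor_inject[symmetric] Rep fun_eq_iff unitary_rep_zero[OF \<rho>]
        unitary_rep_zero[OF \<pi>])
  have add: "?\<sigma> s (S + T) = ?\<sigma> s S + ?\<sigma> s T" for s S T
    by (simp add: Rep_htensor_inject[symmetric] Rep fun_eq_iff plus_htensor.rep_eq lin)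
  have scale: "?\<sigma> s (r *\<^sub>R T) = r *\<^sub>R ?\<sigma> s T" for s r T
    by (simp add: Rep_htensor_inject[symmetric] Rep fun_eq_iff scaleR_htensor.rep_eq lin)
  have scaleC: "?\<sigma> s (c *\<^sub>C T) = c *\<^sub>C ?\<sigma> s T" for s c T
    by (simp add: Rep_htensor_inject[symmetric] Rep fun_eq_iff scaleC_htensor.rep_eq lin)
  have inner: "cinner (?\<sigma> s S) (?\<sigma> s T) = cinner S T" for s S T
  proof -
    note o = orthonormal_basis_unitary[OF u(2)[of "- s"] some_onb]
    have "((\<lambda>v. cinner (Rep_htensor S (\<pi> (- s) v)) (Rep_htensor T (\<pi> (- s) v))) has_sum cinner S T) some_onb"
      using cinner_htensor_has_sum[OF o(1), of S T] by (simp add: has_sum_reindex[OF o(2)] o_def)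
    moreover have "cinner (\<rho> s x) (\<rho> s y) = cinner x y" for x y
      using u(1)[of s] by (simp add: unitary_def)
    ultimately show ?thesis
      using cinner_htensor_has_sum[OF some_onb, of "?\<sigma> s S" "?\<sigma> s T"]
      by (simp add: Rep has_sum_unique)
  qed
  have norm: "norm (?\<sigma> s T) = norm T" for s T by (simp add: norm_eq_sqrt_cinner inner)
  have bl: "bounded_linear (?\<sigma> s)" for s
    by (rule bounded_linear_intro[where K = 1]) (simp_all add: add scale norm)
  have "surj (?\<sigma> s)" for s
    by (rule surjI[of _ "?\<sigma> (- s)"]) (simp add: hom\<sigma>[symmetric] zero)
  then have uni: "unitary (?\<sigma> s)" for s
    by (simp add: unitary_def bounded_clinear_def bl scaleC inner)
  have cont: "continuous_on UNIV (\<lambda>s. ?\<sigma> s T)" for T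
  proof -
    let ?X = "\<lambda>F. \<Sum>u\<in>F. tensor (Rep_htensor T u) u"
    have "continuous_on UNIV (\<lambda>s. ?\<sigma> s (?X F))" for F
    proof -
      have "?\<sigma> s (?X F) = (\<Sum>u\<in>F. tensor (\<rho> s (Rep_htensor T u)) (\<pi> s u))" for s
        by (simp add: linear_sum[OF bounded_linear.linear[OF bl]] tensor_rep_tensor[OF \<rho> \<pi>])
      moreover have "continuous_on UNIV (\<lambda>s. tensor (\<rho> s x) (\<pi> s y))" for x y
        using \<rho> \<pi> unfolding unitary_rep_def
        by (intro bounded_bilinear.continuous_on[OF bounded_bilinear_tensor]) auto
      ultimately show ?thesis by (simp add: continuous_on_sum)
    qed
    moreover have "uniform_limit UNIV (\<lambda>F s. ?\<sigma> s (?X F)) (\<lambda>s. ?\<sigma> s T) (finite_subsets_at_top some_onb)"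
    proof (rule uniform_limitI)
      fix e :: real assume "e > 0"
      have "dist (?\<sigma> s S) (?\<sigma> s R) = dist S R" for s S R
        using norm[of s "S - R"] by (simp add: dist_norm linear_diff[OF bounded_linear.linear[OF bl]])
      then show "\<forall>\<^sub>F F in finite_subsets_at_top some_onb. \<forall>s\<in>UNIV. dist (?\<sigma> s (?X F)) (?\<sigma> s T) < e"
        using tendstoD[OF tensor_expansion[OF some_onb, of T, unfolded has_sum_def] \<open>e > 0\<close>] by simp
    qed
    ultimately show ?thesis
      by (intro uniform_limit_theorem[where F = "finite_subsets_at_top some_onb"]) auto
  qed
  show ?thesis
    unfolding unitary_rep_def using uni cont by (auto simp: fun_eq_iff hom\<sigma>)
qed

text \<open>
  The integral \<open>\<pi>(\<mu>) = \<integral> \<pi>(s) d\<mu>(s)\<close> is taken in the weak sense, because the Bochner integral of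
  the library only covers separable spaces; see \<open>cinner_rep_integral\<close> for its existence.
\<close>

definition weak_integral :: "'s measure \<Rightarrow> ('s \<Rightarrow> 'a::chilbert_space) \<Rightarrow> 'a" where
  "weak_integral M f = (THE z. \<forall>x. cinner x z = (LINT s|M. cinner x (f s)))"

definition rep_integral ::
  "('g \<Rightarrow> 'a::chilbert_space \<Rightarrow> 'a) \<Rightarrow> 'g measure \<Rightarrow> 'a \<Rightarrow> 'a" where
  "rep_integral \<pi> \<mu> y = weak_integral \<mu> (\<lambda>s. \<pi> s y)"

lemma cinner_rep_integral:
  fixes \<pi> :: "'g::topological_group_add \<Rightarrow> 'a::chilbert_space \<Rightarrow> 'a"
  assumes \<pi>: "unitary_rep \<pi>" and "finite_measure \<mu>" and sets: "sets \<mu> = sets borel"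
  shows "cinner x (rep_integral \<pi> \<mu> y) = (LINT s|\<mu>. cinner x (\<pi> s y))"
proof -
  interpret finite_measure \<mu> by fact
  have norm: "norm (\<pi> s y) = norm y" for s
    using \<pi> by (simp add: norm_eq_sqrt_cinner unitary_rep_def unitary_def)
  have cont: "continuous_on UNIV (\<lambda>s. \<pi> s y)" using \<pi> by (simp add: unitary_rep_def)
  have int: "integrable \<mu> (\<lambda>s. cinner (\<pi> s y) x)" for x
  proof (rule integrable_const_bound[where B = "norm y * norm x"])
    show "AE s in \<mu>. norm (cinner (\<pi> s y) x) \<le> norm y * norm x"
      using norm_cinner_le by (metis (mono_tags, lifting) AE_I2 norm)
    have "continuous_on UNIV (\<lambda>s. cinner (\<pi> s y) x)"
      by (rule bounded_bilinear.continuous_on[OF bounded_bilinear_cinner cont continuous_on_const])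
    then show "(\<lambda>s. cinner (\<pi> s y) x) \<in> borel_measurable \<mu>"
      using borel_measurable_continuous_onI measurable_cong_sets[OF sets refl] by blast
  qed
  define f where "f x = (LINT s|\<mu>. cinner (\<pi> s y) x)" for x
  have "bounded_clinear f"
    unfolding bounded_clinear_def
  proof (intro conjI allI bounded_linear_intro[where K = "norm y * measure \<mu> (space \<mu>)"])
    fix u v :: 'a and r :: real and c :: complex
    show "f (u + v) = f u + f v" by (simp add: f_def cinner_add_right int)
    show "f (c *\<^sub>C u) = c *\<^sub>C f u" by (simp add: f_def cinner_scaleC_right scaleC_complex_def)
    show "f (r *\<^sub>R u) = r *\<^sub>R f u"
      by (simp add: f_def scaleR_scaleC[of r u] cinner_scaleC_right scaleR_conv_of_real)
    have "norm (f u) \<le> (LINT s|\<mu>. norm (cinner (\<pi> s y) u))"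
      unfolding f_def by (rule integral_norm_bound)
    also have "\<dots> \<le> (LINT s|\<mu>. norm y * norm u)"
      using norm_cinner_le[of "\<pi> _ y" u] by (intro integral_mono) (auto simp: norm int)
    finally show "norm (f u) \<le> norm u * (norm y * measure \<mu> (space \<mu>))" by (simp add: mult_ac)
  qed
  then obtain z where z: "\<And>x. f x = cinner z x" using riesz by blast
  have zi: "cinner x z = (LINT s|\<mu>. cinner x (\<pi> s y))" for x
  proof -
    have "cinner x z = cnj (f x)" using z[of x] cinner_commute[of x z] by simp
    also have "\<dots> = (LINT s|\<mu>. cnj (cinner (\<pi> s y) x))" unfolding f_def by simp
    also have "\<dots> = (LINT s|\<mu>. cinner x (\<pi> s y))" by (simp add: cinner_commute[symmetric])
    finally show ?thesis .
  qed
  have "rep_integral \<pi> \<mu> y = z"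
    unfolding rep_integral_def weak_integral_def
  proof (rule the_equality)
    fix z' assume "\<forall>x. cinner x z' = (LINT s|\<mu>. cinner x (\<pi> s y))"
    then show "z' = z" using zi by (metis cinner_ext)
  qed (use zi in blast)
  then show ?thesis using zi by simp
qed

definition G_positive :: "('g \<Rightarrow> 'a::chilbert_space \<Rightarrow> 'a) \<Rightarrow> 'a \<Rightarrow> bool" where
  "G_positive \<rho> \<xi> \<longleftrightarrow> (\<forall>s. cinner \<xi> (\<rho> s \<xi>) \<in> \<real>\<^sub>\<ge>\<^sub>0)"

definition separating :: "'a::chilbert_space set \<Rightarrow> bool" where
  "separating P \<longleftrightarrow>
     (\<forall>S :: 'a \<Rightarrow> 'a. bounded_clinear S \<and> (\<forall>\<xi>\<in>P. S \<xi> = 0) \<longrightarrow> S = (\<lambda>_. 0))"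

end

theory Submission
  imports Defs "HOL-Probability.Giry_Monad"
begin

text \<open>
  Write \<open>\<sigma> = \<rho> \<otimes> \<pi>\<close>, \<open>c = \<parallel>\<rho>(\<mu>)\<parallel>\<close> and let \<open>\<nu>\<close> be the convolution of the reflection of \<open>\<mu>\<close> with
  \<open>\<mu>\<close>. Since integrated representations turn convolution into composition and reflection into
  the adjoint, \<open>\<tau>(\<nu>) = \<tau>(\<mu>)\<^sup>* \<tau>(\<mu>)\<close> for every unitary representation \<open>\<tau>\<close>, and all powers
  \<open>\<tau>(\<nu>)\<^sup>n\<close> are again of the form \<open>\<tau>(\<nu>\<^sub>n)\<close> with a probability measure \<open>\<nu>\<^sub>n\<close>, the same for \<open>\<rho>\<close> and for \<open>\<sigma>\<close>.

  For a positive vector \<open>\<xi>\<close> the coefficient \<open>\<langle>\<xi> \<otimes> \<eta>, \<sigma>(s) (\<xi> \<otimes> \<eta>)\<rangle> = \<langle>\<xi>, \<rho>(s) \<xi>\<rangle> \<langle>\<eta>, \<pi>(s) \<eta>\<rangle>\<close> has real part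
  at most \<open>\<parallel>\<eta>\<parallel>\<^sup>2 \<langle>\<xi>, \<rho>(s) \<xi>\<rangle>\<close>. Integrating over \<open>\<nu>\<^sub>2\<^sub>n\<close> gives
  \<open>\<parallel>\<sigma>(\<nu>)\<^sup>n (\<xi> \<otimes> \<eta>)\<parallel> \<le> \<parallel>\<xi>\<parallel> \<parallel>\<eta>\<parallel> c\<^sup>2\<^sup>n\<close> (lemma \<open>tensor_growth\<close>). Thus \<open>\<sigma>(\<nu>)\<close> has growth rate at most
  \<open>c\<^sup>2\<close> on each \<open>\<xi> \<otimes> \<eta>\<close>. These estimates have constants that depend on the vector, so they do not
  pass directly to the closed span.

  For a self-adjoint operator \<open>B\<close>, however, the sequence \<open>\<parallel>B\<^sup>n v\<parallel>\<close> is log-convex, so its growth rate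
  bounds already its first ratio: \<open>\<parallel>B\<^sup>n v\<parallel> \<le> C r\<^sup>n\<close> for all \<open>n\<close> improves itself to
  \<open>\<parallel>B\<^sup>n v\<parallel> \<le> r\<^sup>n \<parallel>v\<parallel>\<close>. The first condition on \<open>v\<close> is linear, the second one is closed; being
  equivalent, they define a closed subspace, namely the spectral subspace of \<open>[-r, r]\<close>. If it
  contains a set with trivial orthogonal complement, then it is everything, and \<open>\<parallel>B\<parallel> \<le> r\<close>
  (lemma \<open>self_adjoint_bound_from_growth\<close>). Separation says that \<open>P\<close>, and hence the set of
  the \<open>\<xi> \<otimes> \<eta>\<close> with \<open>\<xi> \<in> P\<close>, has trivial orthogonal complement. Therefore
  \<open>\<parallel>\<sigma>(\<mu>)\<parallel>\<^sup>2 = \<parallel>\<sigma>(\<nu>)\<parallel> \<le> c\<^sup>2\<close>.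
\<close>

section \<open>Closed subspaces with trivial orthogonal complement\<close>

definition complex_subspace :: "'a::chilbert_space set \<Rightarrow> bool" where
  "complex_subspace W \<longleftrightarrow> 0 \<in> W \<and> (\<forall>x\<in>W. \<forall>y\<in>W. x + y \<in> W) \<and> (\<forall>c. \<forall>x\<in>W. c *\<^sub>C x \<in> W)"

lemma parallelogram_law:
  fixes x y :: "'a::chilbert_space"
  shows "(norm (x + y))\<^sup>2 + (norm (x - y))\<^sup>2 = 2 * (norm x)\<^sup>2 + 2 * (norm y)\<^sup>2"
  by (simp add: norm_sq_cinner cinner_add_left cinner_add_right cinner_diff_left cinner_diff_right)

text \<open>
  A minimising sequence is Cauchy: the midpoint of two of its members lies in \<open>W\<close>, so it is not
  closer to \<open>x\<close> than the infimum, and the parallelogram law then makes the two members close to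
  each other.
\<close>

lemma closest_point_in_closed_subspace:
  fixes W :: "'a::chilbert_space set"
  assumes W: "complex_subspace W" and "closed W"
  obtains p where "p \<in> W" "\<And>w. w \<in> W \<Longrightarrow> norm (x - p) \<le> norm (x - w)"
proof -
  define d where "d = infdist x W"
  have W0: "W \<noteq> {}" using W by (auto simp: complex_subspace_def)
  have d0: "d \<ge> 0" by (simp add: d_def infdist_nonneg)
  have d_le: "d \<le> norm (x - w)" if "w \<in> W" for w
    using infdist_le[OF that, of x] by (simp add: d_def dist_norm)
  have "\<exists>w\<in>W. norm (x - w) < d + 1 / Suc n" for n
  proof -
    have "(INF w\<in>W. dist x w) < d + 1 / Suc n" using W0 by (simp add: d_def infdist_notempty)
    moreover have "bdd_below (dist x ` W)" by (rule bdd_belowI2[of _ 0]) simp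
    ultimately show ?thesis using cINF_less_iff[OF W0, of "dist x"] by (simp only: dist_norm)
  qed
  then obtain w where w: "\<And>n. w n \<in> W" "\<And>n. norm (x - w n) < d + 1 / Suc n" by metis
  have mid: "(norm (w m - w n))\<^sup>2 \<le> 2 * (d + 1 / Suc m)\<^sup>2 + 2 * (d + 1 / Suc n)\<^sup>2 - 4 * d\<^sup>2" for m n
  proof -
    let ?h = "(1/2) *\<^sub>R (w m + w n)"
    have "?h \<in> W" using W w(1) by (simp add: complex_subspace_def scaleR_scaleC)
    then have "d \<le> norm (x - ?h)" by (rule d_le)
    then have "d\<^sup>2 \<le> (norm (x - ?h))\<^sup>2" using d0 by (rule power_mono)
    moreover have "(x - w m) + (x - w n) = 2 *\<^sub>R (x - ?h)"
      by (simp add: scaleR_diff_right scaleR_2)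
    ultimately have "4 * d\<^sup>2 \<le> (norm ((x - w m) + (x - w n)))\<^sup>2"
      by (simp add: power_mult_distrib)
    moreover have "(norm ((x - w m) - (x - w n)))\<^sup>2 = (norm (w m - w n))\<^sup>2"
      by (simp add: norm_minus_commute)
    moreover have "(norm (x - w k))\<^sup>2 \<le> (d + 1 / Suc k)\<^sup>2" for k
      using w(2)[of k] by (intro power_mono) auto
    ultimately show ?thesis
      using parallelogram_law[of "x - w m" "x - w n"] by (smt (verit))
  qed
  have "Cauchy w"
  proof (rule metric_CauchyI)
    fix e :: real assume "e > 0"
    have "(\<lambda>n. 4 * (d + 1 / Suc n)\<^sup>2) \<longlonglongrightarrow> 4 * (d + 0)\<^sup>2"
      by (intro tendsto_intros LIMSEQ_Suc[OF lim_1_over_n])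
    then have "\<forall>\<^sub>F n in sequentially. 4 * (d + 1 / Suc n)\<^sup>2 < 4 * d\<^sup>2 + e\<^sup>2"
      by (rule order_tendstoD(2)) (use \<open>e > 0\<close> in simp)
    then obtain N where N: "4 * (d + 1 / Suc N)\<^sup>2 < 4 * d\<^sup>2 + e\<^sup>2"
      using eventually_happens'[OF sequentially_bot] by blast
    have "dist (w m) (w n) < e" if "m \<ge> N" "n \<ge> N" for m n
    proof -
      have "(d + 1 / Suc k)\<^sup>2 \<le> (d + 1 / Suc N)\<^sup>2" if "k \<ge> N" for k
        using that d0 by (intro power_mono add_left_mono divide_left_mono) auto
      from this[OF that(1)] this[OF that(2)] mid[of m n] N
      have "(norm (w m - w n))\<^sup>2 < e\<^sup>2" by linarith
      then show ?thesis
        using \<open>e > 0\<close> by (simp add: dist_norm power_less_imp_less_base)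
    qed
    then show "\<exists>M. \<forall>m\<ge>M. \<forall>n\<ge>M. dist (w m) (w n) < e" by blast
  qed
  then obtain p where p: "w \<longlonglongrightarrow> p" using Cauchy_convergent convergent_def by blast
  show ?thesis
  proof (rule that[of p])
    show "p \<in> W" using \<open>closed W\<close> w(1) p by (rule closed_sequentially)
    have "norm (x - p) \<le> d + 0"
    proof (rule LIMSEQ_le)
      show "(\<lambda>n. norm (x - w n)) \<longlonglongrightarrow> norm (x - p)" by (intro tendsto_intros p)
      show "(\<lambda>n. d + 1 / Suc n) \<longlonglongrightarrow> d + 0"
        by (intro tendsto_intros LIMSEQ_Suc[OF lim_1_over_n])
    qed (use w(2) less_imp_le in blast)
    then show "norm (x - p) \<le> norm (x - w')" if "w' \<in> W" for w' using d_le[OF that] by simp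
  qed
qed

text \<open>
  The difference of a vector and its closest point in \<open>W\<close> is orthogonal to \<open>W\<close>.
\<close>

lemma closed_subspace_eq_UNIV:
  fixes W :: "'a::chilbert_space set"
  assumes W: "complex_subspace W" and "closed W"
    and perp: "\<And>z. (\<forall>w\<in>W. cinner w z = 0) \<Longrightarrow> z = 0"
  shows "W = UNIV"
proof -
  have "x \<in> W" for x
  proof -
    obtain p where p: "p \<in> W" "\<And>w. w \<in> W \<Longrightarrow> norm (x - p) \<le> norm (x - w)"
      using closest_point_in_closed_subspace[OF assms(1,2)] by blast
    have "cinner w (x - p) = 0" if "w \<in> W" for w
    proof (cases "w = 0")
      case False
      define c where "c = cinner w (x - p) / of_real ((norm w)\<^sup>2)"
      define z where "z = x - p - c *\<^sub>C w"
      have cw: "cinner w z = 0"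
        using False unfolding z_def c_def
        by (simp add: cinner_diff_right[of _ "x - p"] cinner_scaleC_right cinner_eq_norm)
      then have wc: "cinner z w = 0" using cinner_commute[of z w] by simp
      have "x - p = z + c *\<^sub>C w" by (simp add: z_def)
      then have "(norm (x - p))\<^sup>2 = (norm z)\<^sup>2 + (norm (c *\<^sub>C w))\<^sup>2"
        by (simp only: norm_sq_cinner cinner_add_left cinner_add_right cinner_scaleC_left
            cinner_scaleC_right cw wc) simp
      moreover have "p + c *\<^sub>C w \<in> W" using W p(1) that by (simp add: complex_subspace_def)
      then have "norm (x - p) \<le> norm z" using p(2) by (fastforce simp: z_def algebra_simps)
      then have "(norm (x - p))\<^sup>2 \<le> (norm z)\<^sup>2" by (simp add: power_mono)
      ultimately have "c = 0" using False by simp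
      then show ?thesis using False by (simp add: c_def)
    qed simp
    then have "x - p = 0" using perp by blast
    then show ?thesis using p(1) by simp
  qed
  then show ?thesis by blast
qed

text \<open>
  The operator that tests separation is \<open>x \<mapsto> \<langle>z, x\<rangle> z\<close>, of rank at most one.
\<close>

lemma separating_orthogonal_complement:
  assumes "separating P" and z: "\<forall>\<xi>\<in>P. cinner \<xi> z = 0"
  shows "z = 0"
proof -
  let ?S = "\<lambda>x. cinner z x *\<^sub>C z"
  have "bounded_clinear ?S"
    unfolding bounded_clinear_def
    using bounded_linear_compose[OF bounded_linear_scaleC_left bounded_linear_cinner_right]
    by (simp add: cinner_scaleC_right scaleC_scaleC)
  moreover have "?S \<xi> = 0" if "\<xi> \<in> P" for \<xi>
    using z that cinner_commute[of z \<xi>] by simp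
  ultimately have "?S = (\<lambda>_. 0)" using assms(1) unfolding separating_def by blast
  then have "norm (?S z) = 0" by (metis norm_zero)
  then show ?thesis by (simp add: cinner_eq_norm)
qed

section \<open>Self-adjoint operators and local growth rates\<close>

text \<open>
  By log-convexity the ratios \<open>a (n + 1) / a n\<close> increase, so an initial ratio above \<open>r\<close> would
  force growth at a rate above \<open>r\<close>.
\<close>

lemma log_convex_growth:
  fixes a :: "nat \<Rightarrow> real"
  assumes nonneg: "\<And>n. a n \<ge> 0"
    and convex: "\<And>n. (a (Suc n))\<^sup>2 \<le> a n * a (Suc (Suc n))"
    and bound: "\<And>n. a n \<le> C * r ^ n" and "r \<ge> 0"
  shows "a 1 \<le> r * a 0"
proof (rule ccontr)
  assume "\<not> a 1 \<le> r * a 0"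
  then have gt: "r * a 0 < a 1" by simp
  have a0: "a 0 > 0"
  proof (rule ccontr)
    assume "\<not> a 0 > 0"
    then have "a 0 = 0" using nonneg[of 0] by simp
    then show False using convex[of 0] gt by simp
  qed
  define q where "q = a 1 / a 0"
  have q: "r < q" "q > 0" "a 1 = q * a 0"
  proof -
    show "r < q" using gt a0 by (simp add: q_def pos_less_divide_eq)
    then show "q > 0" using \<open>r \<ge> 0\<close> by simp
    show "a 1 = q * a 0" using a0 by (simp add: q_def)
  qed
  have ratio: "a n > 0 \<and> q * a n \<le> a (Suc n)" for n
  proof (induction n)
    case (Suc n)
    then have pos: "a (Suc n) > 0" using q(2) by (smt (verit) mult_pos_pos)
    have "a n * (q * a (Suc n)) \<le> a (Suc n) * a (Suc n)"
      using Suc mult_right_mono[of "q * a n" "a (Suc n)" "a (Suc n)"] pos by (simp add: mult_ac)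
    also have "\<dots> \<le> a n * a (Suc (Suc n))" using convex[of n] by (simp add: power2_eq_square)
    finally show ?case using Suc pos by (simp add: mult_le_cancel_left)
  qed (use a0 q in simp)
  have low: "q ^ n * a 0 \<le> a n" for n
  proof (induction n)
    case (Suc n)
    have "q ^ Suc n * a 0 \<le> q * a n" using Suc q(2) by (simp add: mult.assoc)
    then show ?case using ratio[of n] by linarith
  qed simp
  show False
  proof (cases "r = 0")
    case True
    then have "a 1 \<le> 0" using bound[of 1] by simp
    moreover have "a 1 > 0" unfolding q(3) using q(2) a0 by (rule mult_pos_pos)
    ultimately show False by simp
  next
    case False
    then have r: "r > 0" using \<open>r \<ge> 0\<close> by simp
    then have "1 < q / r" using q by simp
    then obtain n where n: "C / a 0 < (q / r) ^ n" using real_arch_pow by blast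
    have "q ^ n * a 0 \<le> C * r ^ n" using low bound order_trans by blast
    then have "(q / r) ^ n \<le> C / a 0" using r a0 by (simp add: power_divide field_simps)
    then show False using n by simp
  qed
qed

definition self_adjoint :: "('a::chilbert_space \<Rightarrow> 'a) \<Rightarrow> bool" where
  "self_adjoint B \<longleftrightarrow> bounded_clinear B \<and> (\<forall>x y. cinner (B x) y = cinner x (B y))"

lemma bounded_clinear_funpow:
  fixes B :: "'a::chilbert_space \<Rightarrow> 'a"
  assumes "bounded_clinear B"
  shows "bounded_clinear (B ^^ n)"
proof (induction n)
  case 0
  show ?case using bounded_linear_ident by (simp add: bounded_clinear_def)
next
  case (Suc n)
  then show ?case
    using assms bounded_linear_compose[of B "B ^^ n"] by (simp add: bounded_clinear_def o_def)
qed

lemma self_adjoint_funpow: "self_adjoint B \<Longrightarrow> cinner ((B ^^ n) x) y = cinner x ((B ^^ n) y)"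
proof (induction n arbitrary: y)
  case (Suc n)
  have "cinner ((B ^^ Suc n) x) y = cinner ((B ^^ n) x) (B y)"
    using Suc.prems by (simp add: self_adjoint_def)
  also have "\<dots> = cinner x ((B ^^ Suc n) y)"
    using Suc by (simp add: funpow_swap1)
  finally show ?case .
qed simp

lemma self_adjoint_norm_sq:
  assumes "self_adjoint B"
  shows "(norm ((B ^^ n) v))\<^sup>2 = Re (cinner v ((B ^^ (2 * n)) v))"
  by (simp add: norm_sq_cinner self_adjoint_funpow[OF assms] funpow_add mult_2)

text \<open>
  The log-convexity of \<open>\<parallel>B\<^sup>n v\<parallel>\<close> is the Cauchy--Schwarz inequality for
  \<open>\<parallel>B\<^sup>n\<^sup>+\<^sup>1 v\<parallel>\<^sup>2 = \<langle>B\<^sup>n v, B\<^sup>n\<^sup>+\<^sup>2 v\<rangle>\<close>.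
\<close>

lemma self_adjoint_growth:
  assumes B: "self_adjoint B" and "r \<ge> 0" and bound: "\<And>n. norm ((B ^^ n) v) \<le> C * r ^ n"
  shows "norm (B v) \<le> r * norm v"
proof -
  have "(norm ((B ^^ Suc n) v))\<^sup>2 \<le> norm ((B ^^ n) v) * norm ((B ^^ Suc (Suc n)) v)" for n
  proof -
    have "(norm ((B ^^ Suc n) v))\<^sup>2 = Re (cinner ((B ^^ n) v) ((B ^^ Suc (Suc n)) v))"
      using B by (simp add: norm_sq_cinner self_adjoint_def)
    also have "\<dots> \<le> cmod (cinner ((B ^^ n) v) ((B ^^ Suc (Suc n)) v))" by (rule complex_Re_le_cmod)
    also have "\<dots> \<le> norm ((B ^^ n) v) * norm ((B ^^ Suc (Suc n)) v)" by (rule norm_cinner_le)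
    finally show ?thesis .
  qed
  then show ?thesis
    using log_convex_growth[where a = "\<lambda>n. norm ((B ^^ n) v)" and C = C and r = r] bound \<open>r \<ge> 0\<close> by simp
qed

text \<open>
  An elementary substitute for the spectral theorem: the vectors on which \<open>B\<close> grows at rate at
  most \<open>r\<close> form a closed subspace \<open>W\<close>. The form \<open>\<parallel>B\<^sup>n v\<parallel> \<le> \<parallel>v\<parallel> r\<^sup>n\<close> of the growth condition shows
  that \<open>W\<close> is closed, the equivalent form with an arbitrary constant that it is a subspace.
\<close>

lemma self_adjoint_bound_from_growth:
  fixes B :: "'a::chilbert_space \<Rightarrow> 'a"
  assumes B: "self_adjoint B" and r: "r \<ge> 0"
    and growth: "\<And>v. v \<in> V \<Longrightarrow> \<exists>C. \<forall>n. norm ((B ^^ n) v) \<le> C * r ^ n"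
    and total: "\<And>z. (\<forall>v\<in>V. cinner v z = 0) \<Longrightarrow> z = 0"
  shows "norm (B v) \<le> r * norm v"
proof -
  define W where "W = {v. \<forall>n. norm ((B ^^ n) v) \<le> norm v * r ^ n}"
  have pow: "bounded_linear (B ^^ n)" "(B ^^ n) (c *\<^sub>C x) = c *\<^sub>C (B ^^ n) x" for n c x
    using bounded_clinear_funpow[of B n] B by (auto simp: self_adjoint_def bounded_clinear_def)
  \<comment> \<open>An arbitrary constant may be replaced by \<open>norm v\<close>, because \<open>B\<^sup>n v\<close> grows at the same rate as \<open>v\<close>.\<close>
  have W: "v \<in> W" if "\<And>n. norm ((B ^^ n) v) \<le> C * r ^ n" for v C
  proof -
    have "norm ((B ^^ n) v) \<le> norm v * r ^ n" for n
    proof (induction n)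
      case (Suc n)
      have "norm ((B ^^ k) ((B ^^ n) v)) \<le> (C * r ^ n) * r ^ k" for k
        using that[of "k + n"] by (simp add: funpow_add power_add mult_ac)
      then have "norm (B ((B ^^ n) v)) \<le> r * norm ((B ^^ n) v)"
        by (rule self_adjoint_growth[OF B r])
      also have "\<dots> \<le> r * (norm v * r ^ n)" using Suc r by (rule mult_left_mono)
      finally show ?case by (simp add: mult_ac)
    qed simp
    then show ?thesis by (simp add: W_def)
  qed
  have "closed W"
  proof -
    have "closed {v. norm ((B ^^ n) v) \<le> norm v * r ^ n}" for n
      by (intro closed_Collect_le continuous_intros
          bounded_linear.continuous_on[OF pow(1)])
    moreover have "W = (\<Inter>n. {v. norm ((B ^^ n) v) \<le> norm v * r ^ n})" by (auto simp: W_def)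
    ultimately show ?thesis by auto
  qed
  moreover have "complex_subspace W"
    unfolding complex_subspace_def
  proof (intro conjI ballI allI)
    show "0 \<in> W" by (simp add: W_def linear_0[OF bounded_linear.linear[OF pow(1)]])
    fix x y assume x: "x \<in> W" and y: "y \<in> W"
    show "x + y \<in> W"
    proof (rule W[where C = "norm x + norm y"])
      fix n
      have "norm ((B ^^ n) (x + y)) \<le> norm ((B ^^ n) x) + norm ((B ^^ n) y)"
        by (simp add: linear_add[OF bounded_linear.linear[OF pow(1)]] norm_triangle_ineq)
      also have "\<dots> \<le> norm x * r ^ n + norm y * r ^ n"
        using x y by (intro add_mono) (auto simp: W_def)
      finally show "norm ((B ^^ n) (x + y)) \<le> (norm x + norm y) * r ^ n"
        by (simp add: distrib_right)
    qed
  next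
    fix c x assume "x \<in> W"
    then show "c *\<^sub>C x \<in> W" by (simp add: W_def pow(2) mult_left_mono mult.assoc)
  qed
  moreover have "V \<subseteq> W" using growth W by blast
  ultimately have "W = UNIV" using total by (intro closed_subspace_eq_UNIV) blast+
  then have "norm ((B ^^ 1) v) \<le> norm v * r ^ 1" unfolding W_def by blast
  then show ?thesis by (simp add: mult.commute)
qed

section \<open>Convolution of probability measures on a topological group\<close>

definition group_convolution ::
  "'g::{topological_group_add, second_countable_topology} measure \<Rightarrow> 'g measure \<Rightarrow> 'g measure" where
  "group_convolution \<mu> \<nu> = distr (\<mu> \<Otimes>\<^sub>M \<nu>) borel (\<lambda>(s, t). s + t)"

definition reflected :: "'g::topological_group_add measure \<Rightarrow> 'g measure" where
  "reflected \<mu> = distr \<mu> borel uminus"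

primrec convolution_power ::
  "'g::{topological_group_add, second_countable_topology} measure \<Rightarrow> nat \<Rightarrow> 'g measure" where
  "convolution_power \<nu> 0 = return borel 0"
| "convolution_power \<nu> (Suc n) = group_convolution \<nu> (convolution_power \<nu> n)"

definition borel_prob :: "'g::topological_space measure \<Rightarrow> bool" where
  "borel_prob \<mu> \<longleftrightarrow> prob_space \<mu> \<and> sets \<mu> = sets borel"

text \<open>
  Second countability enters here: it identifies the Borel sets of \<open>G \<times> G\<close> with the product
  \<open>\<sigma>\<close>-algebra, and so makes the group operation measurable on product measures.
\<close>

lemma measurable_add_pair:
  fixes \<mu> \<nu> :: "'g::{topological_group_add, second_countable_topology} measure"
  assumes "sets \<mu> = sets borel" "sets \<nu> = sets borel"
  shows "(\<lambda>(s, t). s + t) \<in> \<mu> \<Otimes>\<^sub>M \<nu> \<rightarrow>\<^sub>M borel"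
proof -
  have "(\<lambda>p::'g \<times> 'g. fst p + snd p) \<in> borel \<rightarrow>\<^sub>M borel"
    by (intro borel_measurable_continuous_onI continuous_intros)
  then have "(\<lambda>(s::'g, t::'g). s + t) \<in> borel \<Otimes>\<^sub>M borel \<rightarrow>\<^sub>M borel"
    by (simp add: borel_prod case_prod_beta')
  moreover have "sets (\<mu> \<Otimes>\<^sub>M \<nu>) = sets (borel \<Otimes>\<^sub>M borel)"
    by (rule sets_pair_measure_cong[OF assms])
  ultimately show ?thesis using measurable_cong_sets by blast
qed

lemma measurable_uminus:
  fixes \<mu> :: "'g::topological_group_add measure"
  assumes "sets \<mu> = sets borel"
  shows "uminus \<in> \<mu> \<rightarrow>\<^sub>M borel"
proof -
  have "(uminus :: 'g \<Rightarrow> 'g) \<in> borel \<rightarrow>\<^sub>M borel"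
    by (intro borel_measurable_continuous_onI continuous_intros)
  then show ?thesis using measurable_cong_sets[OF assms refl] by blast
qed

lemma borel_prob_group_convolution:
  assumes "borel_prob \<mu>" "borel_prob \<nu>"
  shows "borel_prob (group_convolution \<mu> \<nu>)"
proof -
  interpret \<mu>: prob_space \<mu> using assms by (simp add: borel_prob_def)
  interpret \<nu>: prob_space \<nu> using assms by (simp add: borel_prob_def)
  interpret pair_prob_space \<mu> \<nu> ..
  show ?thesis
    using assms by (simp add: borel_prob_def group_convolution_def prob_space_distr measurable_add_pair)
qed

lemma borel_prob_reflected: "borel_prob \<mu> \<Longrightarrow> borel_prob (reflected \<mu>)"
  by (simp add: borel_prob_def reflected_def prob_space.prob_space_distr measurable_uminus)

lemma borel_prob_convolution_power: "borel_prob \<nu> \<Longrightarrow> borel_prob (convolution_power \<nu> n)"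
  by (induction n) (auto simp: borel_prob_group_convolution, simp add: borel_prob_def prob_space_return)

section \<open>Integrated representations\<close>

lemma unitary_rep_norm: "unitary_rep \<sigma> \<Longrightarrow> norm (\<sigma> s x) = norm x"
  by (simp add: norm_eq_sqrt_cinner unitary_rep_def unitary_def)

lemma unitary_rep_add: "unitary_rep \<sigma> \<Longrightarrow> \<sigma> (s + t) x = \<sigma> s (\<sigma> t x)"
  by (simp add: unitary_rep_def)

lemma coefficient_measurable:
  assumes "unitary_rep \<sigma>"
  shows "(\<lambda>s. cinner x (\<sigma> s y)) \<in> borel_measurable borel"
  using assms unfolding unitary_rep_def
  by (intro borel_measurable_continuous_onI
      bounded_bilinear.continuous_on[OF bounded_bilinear_cinner continuous_on_const]) blast

lemma coefficient_bound:
  assumes "unitary_rep \<sigma>"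
  shows "cmod (cinner x (\<sigma> s y)) \<le> norm x * norm y"
  using norm_cinner_le[of x "\<sigma> s y"] by (simp add: unitary_rep_norm[OF assms])

lemma coefficient_integrable:
  assumes "unitary_rep \<sigma>" "borel_prob \<mu>"
  shows "integrable \<mu> (\<lambda>s. cinner x (\<sigma> s y))"
proof -
  interpret prob_space \<mu> using assms by (simp add: borel_prob_def)
  show ?thesis
  proof (rule integrable_const_bound[where B = "norm x * norm y"])
    show "(\<lambda>s. cinner x (\<sigma> s y)) \<in> borel_measurable \<mu>"
      using coefficient_measurable[OF assms(1)] assms(2) measurable_cong_sets
      unfolding borel_prob_def by blast
  qed (simp add: coefficient_bound[OF assms(1)])
qed

lemma cinner_rep_integral_prob:
  assumes "unitary_rep \<sigma>" "borel_prob \<mu>"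
  shows "cinner x (rep_integral \<sigma> \<mu> y) = (LINT s|\<mu>. cinner x (\<sigma> s y))"
  using assms by (intro cinner_rep_integral) (auto simp: borel_prob_def prob_space_def)

text \<open>
  The triangle inequality for integrals is applied to \<open>\<parallel>z\<parallel>\<^sup>2 = \<integral> \<langle>z, \<sigma>(s) x\<rangle> d\<mu>(s)\<close> with \<open>z = \<sigma>(\<mu>) x\<close>, since
  the weak integral provides only scalar integrands.
\<close>

lemma bounded_clinear_rep_integral:
  assumes \<sigma>: "unitary_rep \<sigma>" and \<mu>: "borel_prob \<mu>"
  shows "bounded_clinear (rep_integral \<sigma> \<mu>)"
proof -
  note I = cinner_rep_integral_prob[OF \<sigma> \<mu>]
  interpret prob_space \<mu> using \<mu> by (simp add: borel_prob_def)
  have lin: "\<sigma> s (x + y) = \<sigma> s x + \<sigma> s y" "\<sigma> s (c *\<^sub>C x) = c *\<^sub>C \<sigma> s x" for s x y c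
    using \<sigma> linear_add[OF bounded_linear.linear]
    unfolding unitary_rep_def unitary_def bounded_clinear_def by blast+
  have add: "rep_integral \<sigma> \<mu> (x + y) = rep_integral \<sigma> \<mu> x + rep_integral \<sigma> \<mu> y" for x y
    by (rule cinner_ext) (simp add: I cinner_add_right lin coefficient_integrable[OF \<sigma> \<mu>])
  have scale: "rep_integral \<sigma> \<mu> (c *\<^sub>C x) = c *\<^sub>C rep_integral \<sigma> \<mu> x" for c x
    by (rule cinner_ext) (simp add: I cinner_scaleC_right lin)
  have norm: "norm (rep_integral \<sigma> \<mu> x) \<le> norm x" for x
  proof -
    let ?z = "rep_integral \<sigma> \<mu> x"
    have "(norm ?z)\<^sup>2 = cmod (cinner ?z ?z)" by (simp add: cinner_eq_norm norm_power)
    also have "\<dots> = cmod (LINT s|\<mu>. cinner ?z (\<sigma> s x))" by (simp add: I)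
    also have "\<dots> \<le> (LINT s|\<mu>. cmod (cinner ?z (\<sigma> s x)))" by (rule integral_norm_bound)
    also have "\<dots> \<le> (LINT s|\<mu>. norm ?z * norm x)"
      by (intro integral_mono integrable_norm coefficient_integrable[OF \<sigma> \<mu>] coefficient_bound[OF \<sigma>]) simp
    also have "\<dots> = norm ?z * norm x" by (simp add: prob_space)
    finally have "norm ?z * norm ?z \<le> norm ?z * norm x" by (simp add: power2_eq_square)
    then show ?thesis by (cases "?z = 0") (auto simp: mult_le_cancel_left)
  qed
  show ?thesis
    unfolding bounded_clinear_def
  proof (intro conjI allI bounded_linear_intro[where K = 1])
    show "rep_integral \<sigma> \<mu> (r *\<^sub>R x) = r *\<^sub>R rep_integral \<sigma> \<mu> x" for r x
      using scale by (simp add: scaleR_scaleC)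
  qed (use add scale norm in simp_all)
qed

lemma rep_integral_return:
  fixes \<sigma> :: "'g::topological_group_add \<Rightarrow> 'a::chilbert_space \<Rightarrow> 'a"
  assumes "unitary_rep \<sigma>"
  shows "rep_integral \<sigma> (return borel 0) x = x"
proof (rule cinner_ext)
  have "borel_prob (return borel (0::'g))" by (simp add: borel_prob_def prob_space_return)
  then show "cinner z (rep_integral \<sigma> (return borel 0) x) = cinner z x" for z
    using integral_return[where x = 0, OF _ coefficient_measurable[OF assms, of z x]]
    by (simp add: cinner_rep_integral_prob[OF assms] unitary_rep_zero[OF assms])
qed

text \<open>
  Fubini's theorem for the coefficient \<open>\<langle>z, \<sigma>(s + t) x\<rangle> = \<langle>\<sigma>(- s) z, \<sigma>(t) x\<rangle>\<close>; moving \<open>\<sigma>(s)\<close> to the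
  left makes the inner integral a coefficient of \<open>\<sigma>(\<nu>) x\<close>.
\<close>

lemma rep_integral_group_convolution:
  assumes \<sigma>: "unitary_rep \<sigma>" and \<mu>: "borel_prob \<mu>" and \<nu>: "borel_prob \<nu>"
  shows "rep_integral \<sigma> (group_convolution \<mu> \<nu>) x = rep_integral \<sigma> \<mu> (rep_integral \<sigma> \<nu> x)"
proof (rule cinner_ext)
  fix z
  interpret \<mu>: prob_space \<mu> using \<mu> by (simp add: borel_prob_def)
  interpret \<nu>: prob_space \<nu> using \<nu> by (simp add: borel_prob_def)
  interpret pair_prob_space \<mu> \<nu> ..
  have m: "(\<lambda>(s, t). s + t) \<in> \<mu> \<Otimes>\<^sub>M \<nu> \<rightarrow>\<^sub>M borel"
    using \<mu> \<nu> by (intro measurable_add_pair) (auto simp: borel_prob_def)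
  have int: "integrable (\<mu> \<Otimes>\<^sub>M \<nu>) (\<lambda>(s, t). cinner z (\<sigma> (s + t) x))"
  proof (rule P.integrable_const_bound[where B = "norm z * norm x"])
    show "(\<lambda>(s, t). cinner z (\<sigma> (s + t) x)) \<in> borel_measurable (\<mu> \<Otimes>\<^sub>M \<nu>)"
      using measurable_compose[OF m coefficient_measurable[OF \<sigma>, of z x]]
      by (simp add: case_prod_beta')
  qed (auto simp: coefficient_bound[OF \<sigma>])
  have "cinner z (rep_integral \<sigma> (group_convolution \<mu> \<nu>) x)
      = (LINT s|group_convolution \<mu> \<nu>. cinner z (\<sigma> s x))"
    by (rule cinner_rep_integral_prob[OF \<sigma> borel_prob_group_convolution[OF \<mu> \<nu>]])
  also have "\<dots> = (LINT p|(\<mu> \<Otimes>\<^sub>M \<nu>). (case p of (s, t) \<Rightarrow> cinner z (\<sigma> (s + t) x)))"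
    unfolding group_convolution_def
    by (subst integral_distr[OF m coefficient_measurable[OF \<sigma>]]) (simp add: case_prod_beta')
  also have "\<dots> = (LINT s|\<mu>. LINT t|\<nu>. cinner z (\<sigma> (s + t) x))"
    using integral_fst'[OF int] by simp
  also have "\<dots> = (LINT s|\<mu>. LINT t|\<nu>. cinner (\<sigma> (- s) z) (\<sigma> t x))"
    by (simp add: unitary_rep_adjoint[OF \<sigma>] unitary_rep_add[OF \<sigma>])
  also have "\<dots> = (LINT s|\<mu>. cinner z (\<sigma> s (rep_integral \<sigma> \<nu> x)))"
    by (simp only: cinner_rep_integral_prob[OF \<sigma> \<nu>, symmetric], simp only: unitary_rep_adjoint[OF \<sigma>])
  also have "\<dots> = cinner z (rep_integral \<sigma> \<mu> (rep_integral \<sigma> \<nu> x))"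
    by (rule cinner_rep_integral_prob[OF \<sigma> \<mu>, symmetric])
  finally show "cinner z (rep_integral \<sigma> (group_convolution \<mu> \<nu>) x)
      = cinner z (rep_integral \<sigma> \<mu> (rep_integral \<sigma> \<nu> x))" .
qed

lemma rep_integral_convolution_power:
  assumes "unitary_rep \<sigma>" "borel_prob \<nu>"
  shows "rep_integral \<sigma> (convolution_power \<nu> n) x = (rep_integral \<sigma> \<nu> ^^ n) x"
  by (induction n)
    (simp_all add: rep_integral_return assms rep_integral_group_convolution borel_prob_convolution_power)

text \<open>
  Reflection of the measure is the adjoint of the operator, because \<open>\<sigma>(- s) = \<sigma>(s)\<^sup>*\<close>.
\<close>

lemma rep_integral_reflected:
  assumes \<sigma>: "unitary_rep \<sigma>" and \<mu>: "borel_prob \<mu>"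
  shows "cinner x (rep_integral \<sigma> (reflected \<mu>) y) = cinner (rep_integral \<sigma> \<mu> x) y"
proof -
  have sets: "sets \<mu> = sets borel" using \<mu> by (simp add: borel_prob_def)
  have adj: "cinner x (\<sigma> (- s) y) = cnj (cinner y (\<sigma> s x))" for s
    using unitary_rep_adjoint[OF \<sigma>, of s y x] cinner_commute by metis
  have "cinner x (rep_integral \<sigma> (reflected \<mu>) y) = (LINT s|reflected \<mu>. cinner x (\<sigma> s y))"
    by (rule cinner_rep_integral_prob[OF \<sigma> borel_prob_reflected[OF \<mu>]])
  also have "\<dots> = (LINT s|\<mu>. cnj (cinner y (\<sigma> s x)))"
    unfolding reflected_def
    by (subst integral_distr[OF measurable_uminus[OF sets] coefficient_measurable[OF \<sigma>]]) (simp add: adj)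
  also have "\<dots> = cnj (cinner y (rep_integral \<sigma> \<mu> x))"
    by (simp add: cinner_rep_integral_prob[OF \<sigma> \<mu>])
  finally show ?thesis using cinner_commute by metis
qed

text \<open>
  The measure whose operator is \<open>\<sigma>(\<mu>)\<^sup>* \<sigma>(\<mu>)\<close>.
\<close>

definition symmetrised ::
  "'g::{topological_group_add, second_countable_topology} measure \<Rightarrow> 'g measure" where
  "symmetrised \<mu> = group_convolution (reflected \<mu>) \<mu>"

lemma borel_prob_symmetrised: "borel_prob \<mu> \<Longrightarrow> borel_prob (symmetrised \<mu>)"
  by (simp add: symmetrised_def borel_prob_group_convolution borel_prob_reflected)

lemma cinner_rep_integral_symmetrised:
  assumes "unitary_rep \<sigma>" "borel_prob \<mu>"
  shows "cinner x (rep_integral \<sigma> (symmetrised \<mu>) y)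
    = cinner (rep_integral \<sigma> \<mu> x) (rep_integral \<sigma> \<mu> y)"
  by (simp add: symmetrised_def rep_integral_group_convolution assms borel_prob_reflected
      rep_integral_reflected)

lemma self_adjoint_rep_integral_symmetrised:
  assumes "unitary_rep \<sigma>" "borel_prob \<mu>"
  shows "self_adjoint (rep_integral \<sigma> (symmetrised \<mu>))"
  unfolding self_adjoint_def
  using bounded_clinear_rep_integral[OF assms(1) borel_prob_symmetrised[OF assms(2)]]
    cinner_rep_integral_symmetrised[OF assms] cinner_commute by metis

lemma norm_rep_integral_le_onorm:
  assumes "unitary_rep \<sigma>" "borel_prob \<mu>"
  shows "norm (rep_integral \<sigma> \<mu> x) \<le> onorm (rep_integral \<sigma> \<mu>) * norm x"
  using bounded_clinear_rep_integral[OF assms] by (simp add: bounded_clinear_def onorm)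

text \<open>
  The \<open>C\<^sup>*\<close>-inequality \<open>\<parallel>A\<^sup>* A\<parallel> \<le> \<parallel>A\<parallel>\<^sup>2\<close> for \<open>A = \<sigma>(\<mu>)\<close>.
\<close>

lemma norm_rep_integral_symmetrised_le:
  assumes "unitary_rep \<sigma>" "borel_prob \<mu>"
  shows "norm (rep_integral \<sigma> (symmetrised \<mu>) x) \<le> (onorm (rep_integral \<sigma> \<mu>))\<^sup>2 * norm x"
proof -
  let ?A = "rep_integral \<sigma> \<mu>" and ?z = "rep_integral \<sigma> (symmetrised \<mu>) x"
  have c0: "onorm ?A \<ge> 0"
    using bounded_clinear_rep_integral[OF assms] by (simp add: bounded_clinear_def onorm_pos_le)
  have "norm ?z * norm ?z = cmod (cinner ?z ?z)"
    unfolding cinner_eq_norm norm_of_real by (simp add: power2_eq_square)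
  also have "\<dots> = cmod (cinner (?A ?z) (?A x))" by (simp only: cinner_rep_integral_symmetrised[OF assms])
  also have "\<dots> \<le> norm (?A ?z) * norm (?A x)" by (rule norm_cinner_le)
  also have "\<dots> \<le> (onorm ?A * norm ?z) * (onorm ?A * norm x)"
    using c0 by (intro mult_mono norm_rep_integral_le_onorm[OF assms]) auto
  finally have "norm ?z * norm ?z \<le> norm ?z * ((onorm ?A)\<^sup>2 * norm x)"
    by (simp add: power2_eq_square mult_ac)
  then show ?thesis using c0 by (cases "?z = 0") (auto simp: mult_le_cancel_left)
qed

lemma norm_rep_integral_power_le:
  assumes "unitary_rep \<sigma>" "borel_prob \<mu>"
  shows "norm ((rep_integral \<sigma> (symmetrised \<mu>) ^^ n) x) \<le> ((onorm (rep_integral \<sigma> \<mu>))\<^sup>2) ^ n * norm x"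
proof (induction n)
  case (Suc n)
  let ?r = "(onorm (rep_integral \<sigma> \<mu>))\<^sup>2"
  have "norm ((rep_integral \<sigma> (symmetrised \<mu>) ^^ Suc n) x)
      \<le> ?r * norm ((rep_integral \<sigma> (symmetrised \<mu>) ^^ n) x)"
    using norm_rep_integral_symmetrised_le[OF assms] by simp
  also have "\<dots> \<le> ?r * (?r ^ n * norm x)" using Suc by (rule mult_left_mono) simp
  finally show ?case by (simp add: mult_ac)
qed simp

section \<open>Tensoring with a representation that has positive vectors\<close>

text \<open>
  The only use of positivity: multiplying by \<open>\<langle>\<xi>, \<rho>(s) \<xi>\<rangle> \<ge> 0\<close> preserves the pointwise bound
  \<open>Re \<langle>\<eta>, \<pi>(s) \<eta>\<rangle> \<le> \<parallel>\<eta>\<parallel>\<^sup>2\<close>, which eliminates \<open>\<pi>\<close>.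
\<close>

lemma tensor_coefficient_le:
  assumes \<rho>: "unitary_rep \<rho>" and \<pi>: "unitary_rep \<pi>" and \<nu>: "borel_prob \<nu>"
    and pos: "G_positive \<rho> \<xi>"
  shows "Re (cinner (tensor \<xi> \<eta>) (rep_integral (tensor_rep \<rho> \<pi>) \<nu> (tensor \<xi> \<eta>)))
    \<le> (norm \<eta>)\<^sup>2 * Re (cinner \<xi> (rep_integral \<rho> \<nu> \<xi>))"
proof -
  note \<sigma> = unitary_rep_tensor_rep[OF \<rho> \<pi>]
  have co: "cinner (tensor \<xi> \<eta>) (tensor_rep \<rho> \<pi> s (tensor \<xi> \<eta>))
      = cinner \<xi> (\<rho> s \<xi>) * cinner \<eta> (\<pi> s \<eta>)" for s
    by (simp add: tensor_rep_tensor[OF \<rho> \<pi>] cinner_tensor)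
  have "Re (cinner (tensor \<xi> \<eta>) (tensor_rep \<rho> \<pi> s (tensor \<xi> \<eta>))) \<le> (norm \<eta>)\<^sup>2 * Re (cinner \<xi> (\<rho> s \<xi>))" for s
  proof -
    have p: "Re (cinner \<xi> (\<rho> s \<xi>)) \<ge> 0" "Im (cinner \<xi> (\<rho> s \<xi>)) = 0"
      using pos by (auto simp: G_positive_def complex_nonneg_Reals_iff)
    have "Re (cinner \<eta> (\<pi> s \<eta>)) \<le> (norm \<eta>)\<^sup>2"
      using complex_Re_le_cmod[of "cinner \<eta> (\<pi> s \<eta>)"] coefficient_bound[OF \<pi>, of \<eta> s \<eta>]
      by (simp add: power2_eq_square)
    then show ?thesis using p by (simp add: co mult.commute mult_left_mono)
  qed
  then have "(LINT s|\<nu>. Re (cinner (tensor \<xi> \<eta>) (tensor_rep \<rho> \<pi> s (tensor \<xi> \<eta>))))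
      \<le> (LINT s|\<nu>. (norm \<eta>)\<^sup>2 * Re (cinner \<xi> (\<rho> s \<xi>)))"
    using coefficient_integrable[OF \<sigma> \<nu>] coefficient_integrable[OF \<rho> \<nu>]
    by (intro integral_mono) auto
  then show ?thesis
    using coefficient_integrable[OF \<sigma> \<nu>] coefficient_integrable[OF \<rho> \<nu>]
    by (simp add: cinner_rep_integral_prob[OF \<sigma> \<nu>] cinner_rep_integral_prob[OF \<rho> \<nu>])
qed

text \<open>
  The square of the left-hand side is a coefficient of \<open>\<sigma>(\<nu>)\<^sup>2\<^sup>n = \<sigma>(\<nu>\<^sub>2\<^sub>n)\<close> at \<open>\<xi> \<otimes> \<eta>\<close>. As \<open>\<nu>\<^sub>2\<^sub>n\<close> is a
  positive measure, this coefficient is controlled by that of \<open>\<rho>(\<nu>\<^sub>2\<^sub>n) = \<rho>(\<nu>)\<^sup>2\<^sup>n\<close> at \<open>\<xi>\<close>.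
\<close>

lemma tensor_growth:
  fixes \<rho> :: "'g::{topological_group_add, second_countable_topology} \<Rightarrow> 'h::chilbert_space \<Rightarrow> 'h"
    and \<pi> :: "'g \<Rightarrow> 'k::chilbert_space \<Rightarrow> 'k"
  assumes \<rho>: "unitary_rep \<rho>" and \<pi>: "unitary_rep \<pi>" and \<mu>: "borel_prob \<mu>"
    and pos: "G_positive \<rho> \<xi>"
  shows "norm ((rep_integral (tensor_rep \<rho> \<pi>) (symmetrised \<mu>) ^^ n) (tensor \<xi> \<eta>))
    \<le> (norm \<xi> * norm \<eta>) * ((onorm (rep_integral \<rho> \<mu>))\<^sup>2) ^ n"
    (is "norm ((?B ^^ n) ?v) \<le> _ * ?r ^ n")
proof (rule power2_le_imp_le)
  note \<sigma> = unitary_rep_tensor_rep[OF \<rho> \<pi>] and \<nu> = borel_prob_symmetrised[OF \<mu>]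
  let ?\<nu> = "convolution_power (symmetrised \<mu>) (2 * n)"
  have "(norm ((?B ^^ n) ?v))\<^sup>2 = Re (cinner ?v ((?B ^^ (2 * n)) ?v))"
    by (rule self_adjoint_norm_sq[OF self_adjoint_rep_integral_symmetrised[OF \<sigma> \<mu>]])
  also have "\<dots> = Re (cinner ?v (rep_integral (tensor_rep \<rho> \<pi>) ?\<nu> ?v))"
    by (simp only: rep_integral_convolution_power[OF \<sigma> \<nu>])
  also have "\<dots> \<le> (norm \<eta>)\<^sup>2 * Re (cinner \<xi> (rep_integral \<rho> ?\<nu> \<xi>))"
    by (rule tensor_coefficient_le[OF \<rho> \<pi> borel_prob_convolution_power[OF \<nu>] pos])
  also have "Re (cinner \<xi> (rep_integral \<rho> ?\<nu> \<xi>)) \<le> norm \<xi> * norm (rep_integral \<rho> ?\<nu> \<xi>)"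
    using complex_Re_le_cmod norm_cinner_le order_trans by blast
  also have "norm (rep_integral \<rho> ?\<nu> \<xi>) \<le> ?r ^ (2 * n) * norm \<xi>"
    unfolding rep_integral_convolution_power[OF \<rho> \<nu>] by (rule norm_rep_integral_power_le[OF \<rho> \<mu>])
  finally have "(norm ((?B ^^ n) ?v))\<^sup>2 \<le> (norm \<eta>)\<^sup>2 * (norm \<xi> * (?r ^ (2 * n) * norm \<xi>))"
    by (simp add: mult_left_mono)
  also have "\<dots> = ((norm \<xi> * norm \<eta>) * ?r ^ n)\<^sup>2"
    by (simp only: power_even_eq power_mult_distrib) (simp add: power2_eq_square mult_ac)
  finally show "(norm ((?B ^^ n) ?v))\<^sup>2 \<le> ((norm \<xi> * norm \<eta>) * ?r ^ n)\<^sup>2" .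
qed simp

theorem theorem3p3:
  fixes \<rho> :: "'g::{topological_group_add, t2_space, second_countable_topology} \<Rightarrow>
      'h::chilbert_space \<Rightarrow> 'h"
    and \<pi> :: "'g \<Rightarrow> 'k::chilbert_space \<Rightarrow> 'k"
    and P :: "'h set"
    and \<mu> :: "'g measure"
  assumes "locally_compact_space (euclidean :: 'g topology)"
    and "unitary_rep \<rho>"
    and "separating P"
    and "\<forall>\<xi>\<in>P. norm \<xi> = 1 \<and> G_positive \<rho> \<xi>"
    and "unitary_rep \<pi>"
    and "prob_space \<mu>" and "sets \<mu> = sets borel"
  shows "onorm (rep_integral (tensor_rep \<rho> \<pi>) \<mu>) \<le> onorm (rep_integral \<rho> \<mu>)"
proof -
  have \<mu>: "borel_prob \<mu>" using assms by (simp add: borel_prob_def)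
  note \<rho> = \<open>unitary_rep \<rho>\<close> and \<pi> = \<open>unitary_rep \<pi>\<close>
  note \<sigma> = unitary_rep_tensor_rep[OF \<rho> \<pi>]
  let ?A = "rep_integral (tensor_rep \<rho> \<pi>) \<mu>"
  let ?B = "rep_integral (tensor_rep \<rho> \<pi>) (symmetrised \<mu>)"
  define c where "c = onorm (rep_integral \<rho> \<mu>)"
  have c0: "c \<ge> 0"
    using bounded_clinear_rep_integral[OF \<rho> \<mu>] by (simp add: c_def bounded_clinear_def onorm_pos_le)
  define V where "V = {tensor \<xi> \<eta> | \<xi> \<eta> :: 'k. \<xi> \<in> P}"
  have B: "norm (?B T) \<le> c\<^sup>2 * norm T" for T
  proof (rule self_adjoint_bound_from_growth[OF self_adjoint_rep_integral_symmetrised[OF \<sigma> \<mu>]])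
    show "\<exists>C. \<forall>n. norm ((?B ^^ n) v) \<le> C * (c\<^sup>2) ^ n" if v: "v \<in> V" for v
      using v assms(4) tensor_growth[OF \<rho> \<pi> \<mu>] unfolding V_def c_def by blast
    show "Z = 0" if Z: "\<forall>v\<in>V. cinner v Z = 0" for Z
    proof (rule tensor_total)
      fix x :: 'h and y :: 'k
      have "\<forall>\<xi>\<in>P. cinner \<xi> (Rep_htensor Z y) = 0"
        using Z by (auto simp: V_def cinner_tensor_left[symmetric])
      then have "Rep_htensor Z y = 0"
        by (rule separating_orthogonal_complement[OF \<open>separating P\<close>])
      then show "cinner (tensor x y) Z = 0" by (simp add: cinner_tensor_left)
    qed
  qed simp
  have "norm (?A T) \<le> c * norm T" for T
  proof (rule power2_le_imp_le)
    have "(norm (?A T))\<^sup>2 = Re (cinner T (?B T))"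
      by (simp add: norm_sq_cinner cinner_rep_integral_symmetrised[OF \<sigma> \<mu>])
    also have "\<dots> \<le> norm T * norm (?B T)"
      using complex_Re_le_cmod norm_cinner_le order_trans by blast
    also have "\<dots> \<le> norm T * (c\<^sup>2 * norm T)" using B by (simp add: mult_left_mono)
    finally show "(norm (?A T))\<^sup>2 \<le> (c * norm T)\<^sup>2"
      by (simp add: power_mult_distrib power2_eq_square mult_ac)
  qed (use c0 in simp)
  then show ?thesis unfolding c_def[symmetric] using c0 by (intro onorm_bound)
qed

end
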